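(* For every $w \in \tilde{S}_n$, the formal power series $\tilde{F}_w(X)$ is a symmetric function, and it lies in $\Lambda^{(n)}$.
   Context: Fix an integer $n \geq 3$; indices are taken modulo $n$. The affine symmetric group $\tilde{S}_n$ is the Coxeter group with generators $s_0,\dots,s_{n-1}$ and relations $s_i^2=1$, $s_is_{i+1}s_i=s_{i+1}s_is_{i+1}$, $s_is_j=s_js_i$ for $|i-j|\geq 2$ (mod $n$); $l(w)$ is the Coxeter length. The affine nilCoxeter algebra $\mathcal{U}_n$ is the $\mathbb{C}$-algebra generated by $u_0,\dots,u_{n-1}$ with relations $u_i^2=0$, $u_iu_{i+1}u_i=u_{i+1}u_iu_{i+1}$, $u_iu_j=u_ju_i$ for $|i-j|\ge 2$ (mod $n$); it has basis $\{u_w : w\in\tilde S_n\}$ where $u_w=u_{\rho_1}\cdots u_{\rho_l}$ for any reduced word $s_{\rho_1}\cdots s_{\rho_l}$ of $w$. For a subset $A\subsetneq\{0,\dots,n-1\}$, let $u_A$ be the product of the $u_a$, $a\in A$, taken in any order such that whenever $i,i+1$ (mod $n$) both lie in $A$, $u_{i+1}$ occurs before $u_i$ (this is well defined). For $0\le k\le n-1$ put $h_k(\mathbf u)=\sum_{A\subseteq\{0,\dots,n-1\},\,|A|=k}u_A$ (so $h_0(\mathbf u)=1$). Let $\mathcal U_n$ act on $\mathbb{C}[\tilde S_n]$ by $u_i\cdot w=s_iw$ if $l(s_iw)>l(w)$ and $u_i\cdot w=0$ otherwise, and let $\langle w,v\rangle=\delta_{wv}$. The affine Stanley symmetric function $\tilde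 F_w(X)$ is the formal power series in $x_1,x_2,\dots$ whose coefficient of $x_1^{a_1}\cdots x_t^{a_t}$, for any finite sequence $(a_1,\dots,a_t)$ of integers in $[0,n-1]$, is $\langle h_{a_t}(\mathbf u)\cdots h_{a_1}(\mathbf u)\cdot 1,\,w\rangle$ (here $1$ denotes the identity of $\tilde S_n$); the monomials with some exponent $\geq n$ have coefficient $0$. $\Lambda^{(n)}$ denotes the $\mathbb C$-span of the monomial symmetric functions $m_\lambda$ with $\lambda_1\le n-1$. *)

theory Defs
  imports
    Complex_Main
    "HOL-Library.Poly_Mapping"
    "HOL-Library.Function_Algebras"
    "HOL-Library.Multiset"
    "HOL-Algebra.QuotRing"
begin

section \<open>The affine symmetric group\<close>

text \<open>\<open>far n i j\<close> says that the distance of \<open>i\<close> and \<open>j\<close> on the cycle of integers modulo \<open>n\<close>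
  is at least 2.\<close>

definition far :: "nat \<Rightarrow> nat \<Rightarrow> nat \<Rightarrow> bool" where
  "far n i j \<longleftrightarrow> i < n \<and> j < n \<and> i \<noteq> j \<and> Suc i mod n \<noteq> j \<and> Suc j mod n \<noteq> i"

abbreviation words :: "nat \<Rightarrow> nat list set" where
  "words n \<equiv> lists {..<n}"

inductive cox_step :: "nat \<Rightarrow> nat list \<Rightarrow> nat list \<Rightarrow> bool" for n where
  square: "i < n \<Longrightarrow> cox_step n (xs @ [i, i] @ ys) (xs @ ys)"
| braid: "i < n \<Longrightarrow> j = Suc i mod n \<Longrightarrow> cox_step n (xs @ [i, j, i] @ ys) (xs @ [j, i, j] @ ys)"
| comm: "far n i j \<Longrightarrow> cox_step n (xs @ [i, j] @ ys) (xs @ [j, i] @ ys)"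

definition cox_rel :: "nat \<Rightarrow> (nat list \<times> nat list) set" where
  "cox_rel n = {(x, y). x \<in> words n \<and> y \<in> words n \<and> equivclp (cox_step n) x y}"

text \<open>The presented group is the monoid of words in the generators modulo the congruence generated
  by the relations; since the generators are involutions no formal inverses are needed
  (see \<open>group_affine_sym\<close> below). Its elements are congruence classes of words.\<close>

definition affine_sym :: "nat \<Rightarrow> nat list set monoid" where
  "affine_sym n = \<lparr>carrier = words n // cox_rel n,
     mult = (\<lambda>X Y. \<Union>x\<in>X. \<Union>y\<in>Y. cox_rel n `` {x @ y}),
     one = cox_rel n `` {[]}\<rparr>"

definition cox_gen :: "nat \<Rightarrow> nat \<Rightarrow> nat list set" where
  "cox_gen n i = cox_rel n `` {[i]}"

definition cox_length :: "nat \<Rightarrow> nat list set \<Rightarrow> nat" where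
  "cox_length n w = (LEAST k. \<exists>xs \<in> words n. length xs = k \<and> cox_rel n `` {xs} = w)"

section \<open>The affine nilCoxeter algebra\<close>

text \<open>Words under concatenation, written additively, so that the library product on
  \<open>free_word \<Rightarrow>\<^sub>0 complex\<close> is the product of the free associative algebra.\<close>

datatype free_word = Free_Word (letters: "nat list")

instantiation free_word :: monoid_add
begin
definition zero_free_word :: free_word where "0 = Free_Word []"
definition plus_free_word :: "free_word \<Rightarrow> free_word \<Rightarrow> free_word" where
  "x + y = Free_Word (letters x @ letters y)"
instance by standard (auto simp: zero_free_word_def plus_free_word_def)
end

type_synonym free_alg = "free_word \<Rightarrow>\<^sub>0 complex"

definition free_algebra :: "nat \<Rightarrow> free_alg ring" where
  "free_algebra n = \<lparr>carrier = {p. \<forall>x \<in> Poly_Mapping.keys p. letters x \<in> words n},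
     mult = (*), one = 1, zero = 0, add = (+)\<rparr>"

definition free_var :: "nat \<Rightarrow> free_alg" where
  "free_var i = Poly_Mapping.single (Free_Word [i]) 1"

definition nil_relators :: "nat \<Rightarrow> free_alg set" where
  "nil_relators n =
     {free_var i * free_var i | i. i < n}
   \<union> {free_var i * free_var j * free_var i - free_var j * free_var i * free_var j | i j.
        i < n \<and> j = Suc i mod n}
   \<union> {free_var i * free_var j - free_var j * free_var i | i j. far n i j}"

text \<open>\<^const>\<open>genideal\<close> is the two-sided ideal generated by a set.\<close>

definition nil_ideal :: "nat \<Rightarrow> free_alg set" where
  "nil_ideal n = Idl\<^bsub>free_algebra n\<^esub> (nil_relators n)"

definition nil_coxeter :: "nat \<Rightarrow> free_alg set ring" where
  "nil_coxeter n = free_algebra n Quot nil_ideal n"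

definition nil_gen :: "nat \<Rightarrow> nat \<Rightarrow> free_alg set" where
  "nil_gen n i = nil_ideal n +>\<^bsub>free_algebra n\<^esub> free_var i"

definition nil_word :: "nat \<Rightarrow> nat list \<Rightarrow> free_alg set" where
  "nil_word n xs = foldr (\<lambda>i X. nil_gen n i \<otimes>\<^bsub>nil_coxeter n\<^esub> X) xs \<one>\<^bsub>nil_coxeter n\<^esub>"

text \<open>\<open>decreasing_word n A xs\<close>: \<open>xs\<close> lists \<open>A\<close> without repetition and \<open>i + 1\<close> (modulo \<open>n\<close>) stands
  before \<open>i\<close> whenever both are in \<open>A\<close>. Such a word exists for \<open>A\<close> a proper subset of
  \<open>{..<n}\<close>, and all of them give the same product, so that the choice below is immaterial
  (see \<open>decreasing_word_exists\<close> and \<open>nil_word_decreasing_unique\<close> below).\<close>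

definition decreasing_word :: "nat \<Rightarrow> nat set \<Rightarrow> nat list \<Rightarrow> bool" where
  "decreasing_word n A xs \<longleftrightarrow> distinct xs \<and> set xs = A \<and>
     (\<forall>p < length xs. \<forall>q < length xs. xs ! p = Suc (xs ! q) mod n \<longrightarrow> p < q)"

definition nil_set :: "nat \<Rightarrow> nat set \<Rightarrow> free_alg set" where
  "nil_set n A = nil_word n (SOME xs. decreasing_word n A xs)"

definition nil_h :: "nat \<Rightarrow> nat \<Rightarrow> free_alg set" where
  "nil_h n k = (\<Oplus>\<^bsub>nil_coxeter n\<^esub>A \<in> {A. A \<subseteq> {..<n} \<and> card A = k}. nil_set n A)"

section \<open>The action on the group algebra\<close>

text \<open>Vectors are finitely supported functions on classes of words; those supported on
  \<open>carrier (affine_sym n)\<close> form the vector space on which the algebra acts.\<close>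

type_synonym vec = "nat list set \<Rightarrow>\<^sub>0 complex"

definition group_space :: "nat \<Rightarrow> vec set" where
  "group_space n = {v. Poly_Mapping.keys v \<subseteq> carrier (affine_sym n)}"

definition basis_vec :: "nat list set \<Rightarrow> vec" where
  "basis_vec w = Poly_Mapping.single w 1"

definition scale_vec :: "complex \<Rightarrow> vec \<Rightarrow> vec" where
  "scale_vec c v = Poly_Mapping.map ((*) c) v"

definition gen_act :: "nat \<Rightarrow> nat \<Rightarrow> vec \<Rightarrow> vec" where
  "gen_act n i v = (\<Sum>w \<in> Poly_Mapping.keys v.
     if cox_length n (cox_gen n i \<otimes>\<^bsub>affine_sym n\<^esub> w) > cox_length n w
     then scale_vec (Poly_Mapping.lookup v w) (basis_vec (cox_gen n i \<otimes>\<^bsub>affine_sym n\<^esub> w))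
     else 0)"

definition free_act :: "nat \<Rightarrow> free_alg \<Rightarrow> vec \<Rightarrow> vec" where
  "free_act n p v = (\<Sum>x \<in> Poly_Mapping.keys p.
     scale_vec (Poly_Mapping.lookup p x) (foldr (gen_act n) (letters x) v))"

text \<open>An element of the quotient algebra acts through any representative
  (see \<open>nil_act_coset\<close> below).\<close>

definition nil_act :: "nat \<Rightarrow> free_alg set \<Rightarrow> vec \<Rightarrow> vec" where
  "nil_act n X v = free_act n (SOME p. p \<in> X) v"

definition pairing :: "vec \<Rightarrow> vec \<Rightarrow> complex" where
  "pairing u v = (\<Sum>w \<in> Poly_Mapping.keys u. Poly_Mapping.lookup u w * Poly_Mapping.lookup v w)"

section \<open>Affine Stanley symmetric functions\<close>

text \<open>A monomial is given by its exponents \<open>nat \<Rightarrow>\<^sub>0 nat\<close>, where index \<open>i\<close> stands for the variable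
  \<open>x\<^bsub>i + 1\<^esub>\<close>, and a formal power series by its coefficients.\<close>

type_synonym power_series = "(nat \<Rightarrow>\<^sub>0 nat) \<Rightarrow> complex"

definition stanley_coeff :: "nat \<Rightarrow> nat list set \<Rightarrow> nat list \<Rightarrow> complex" where
  "stanley_coeff n w as =
     pairing (fold (\<lambda>a. nil_act n (nil_h n a)) as (basis_vec \<one>\<^bsub>affine_sym n\<^esub>)) (basis_vec w)"

text \<open>\<open>Poly_Mapping.degree\<close> is the least \<open>t\<close> such that only the first \<open>t\<close> variables occur.
  Appending zeros to the exponent sequence does not change the coefficient
  (see \<open>affine_stanley_nth\<close> below).\<close>

definition affine_stanley :: "nat \<Rightarrow> nat list set \<Rightarrow> power_series" where
  "affine_stanley n w \<alpha> =
     (if \<forall>i. Poly_Mapping.lookup \<alpha> i \<le> n - 1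
      then stanley_coeff n w (map (Poly_Mapping.lookup \<alpha>) [0..<Poly_Mapping.degree \<alpha>])
      else 0)"

definition symmetric_function :: "power_series \<Rightarrow> bool" where
  "symmetric_function F \<longleftrightarrow>
     (\<forall>\<sigma> \<alpha>. bij \<sigma> \<longrightarrow> F (Poly_Mapping.map_key \<sigma> \<alpha>) = F \<alpha>) \<and>
     (\<exists>d. \<forall>\<alpha>. F \<alpha> \<noteq> 0 \<longrightarrow> (\<Sum>i \<in> Poly_Mapping.keys \<alpha>. Poly_Mapping.lookup \<alpha> i) \<le> d)"

text \<open>Partitions are multisets of positive integers.\<close>

definition monomial_sym :: "nat multiset \<Rightarrow> power_series" where
  "monomial_sym \<mu> \<alpha> =
     (if image_mset (Poly_Mapping.lookup \<alpha>) (mset_set (Poly_Mapping.keys \<alpha>)) = \<mu> then 1 else 0)"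

definition Lambda_bounded :: "nat \<Rightarrow> power_series set" where
  "Lambda_bounded n = module.span (\<lambda>c F \<alpha>. c * F \<alpha>)
     {monomial_sym \<mu> | \<mu>. 0 \<notin># \<mu> \<and> (\<forall>p \<in># \<mu>. p \<le> n - 1)}"

section \<open>Consistency of the definitions\<close>

lemma cox_step_words: "cox_step n x y \<Longrightarrow> x \<in> words n \<longleftrightarrow> y \<in> words n"
  by (induction rule: cox_step.induct) (auto simp: far_def)

lemma cox_step_ctxt: "cox_step n x y \<Longrightarrow> cox_step n (us @ x @ vs) (us @ y @ vs)"
proof (induction rule: cox_step.induct)
  case (square i xs ys)
  from cox_step.square[OF this, of "us @ xs" "ys @ vs"] show ?case by simp
next
  case (braid i j xs ys)
  from cox_step.braid[OF this, of "us @ xs" "ys @ vs"] show ?case by simp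
next
  case (comm i j xs ys)
  from cox_step.comm[OF this, of "us @ xs" "ys @ vs"] show ?case by simp
qed

lemma equivclp_ctxt:
  "equivclp (cox_step n) x y \<Longrightarrow> equivclp (cox_step n) (us @ x @ vs) (us @ y @ vs)"
proof (induction rule: equivclp_induct)
  case base
  show ?case by simp
next
  case (step y z)
  from step(2) have "cox_step n (us @ y @ vs) (us @ z @ vs) \<or> cox_step n (us @ z @ vs) (us @ y @ vs)"
    using cox_step_ctxt by blast
  with step(3) show ?case by (meson equivclp_into_equivclp)
qed

lemma equiv_cox_rel: "equiv (words n) (cox_rel n)"
proof (rule equivI)
  show "cox_rel n \<subseteq> words n \<times> words n" by (auto simp: cox_rel_def)
  show "refl_on (words n) (cox_rel n)" by (auto simp: refl_on_def cox_rel_def)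
  show "sym (cox_rel n)" by (auto simp: sym_def cox_rel_def intro: equivclp_sym)
  show "trans (cox_rel n)" by (auto simp: trans_def cox_rel_def intro: equivclp_trans)
qed

lemma cox_rel_append:
  assumes "(x, x') \<in> cox_rel n" and "(y, y') \<in> cox_rel n"
  shows "(x @ y, x' @ y') \<in> cox_rel n"
proof -
  have "equivclp (cox_step n) (x @ y) (x' @ y)"
    using equivclp_ctxt[of n x x' "[]" y] assms by (auto simp: cox_rel_def)
  moreover have "equivclp (cox_step n) (x' @ y) (x' @ y')"
    using equivclp_ctxt[of n y y' x' "[]"] assms by (auto simp: cox_rel_def)
  ultimately show ?thesis using assms by (auto simp: cox_rel_def intro: equivclp_trans)
qed

lemma affine_sym_mult:
  assumes "x \<in> words n" "y \<in> words n"
  shows "cox_rel n `` {x} \<otimes>\<^bsub>affine_sym n\<^esub> cox_rel n `` {y} = cox_rel n `` {x @ y}"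
proof -
  have "congruent2 (cox_rel n) (cox_rel n) (\<lambda>x y. cox_rel n `` {x @ y})"
    by (rule congruent2I') (metis cox_rel_append equiv_class_eq equiv_cox_rel)
  from UN_equiv_class2[OF equiv_cox_rel equiv_cox_rel this assms]
  show ?thesis by (simp add: affine_sym_def)
qed

lemma affine_sym_carrier: "w \<in> carrier (affine_sym n) \<longleftrightarrow> (\<exists>x \<in> words n. w = cox_rel n `` {x})"
  by (auto simp: affine_sym_def quotient_def)

lemma affine_sym_one: "\<one>\<^bsub>affine_sym n\<^esub> = cox_rel n `` {[]}"
  by (simp add: affine_sym_def)

lemma cox_rel_rev: "x \<in> words n \<Longrightarrow> (rev x @ x, []) \<in> cox_rel n"
proof (induction x)
  case Nil
  show ?case using equiv_cox_rel[of n] by (auto simp: equiv_def refl_on_def)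
next
  case (Cons i x)
  then have "cox_step n (rev x @ [i, i] @ x) (rev x @ x)"
    by (intro cox_step.square) auto
  with Cons have "(rev (i # x) @ i # x, rev x @ x) \<in> cox_rel n"
    by (auto simp: cox_rel_def)
  with Cons show ?case using equiv_cox_rel[of n] by (auto simp: equiv_def elim: transE)
qed

lemma affine_sym_append:
  "x \<in> words n \<Longrightarrow> y \<in> words n \<Longrightarrow> x @ y \<in> words n"
  by simp

lemma group_affine_sym: "group (affine_sym n)"
proof (rule groupI)
  fix X Y assume "X \<in> carrier (affine_sym n)" "Y \<in> carrier (affine_sym n)"
  then show "X \<otimes>\<^bsub>affine_sym n\<^esub> Y \<in> carrier (affine_sym n)"
    unfolding affine_sym_carrier using affine_sym_mult affine_sym_append by metis
next
  show "\<one>\<^bsub>affine_sym n\<^esub> \<in> carrier (affine_sym n)"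
    unfolding affine_sym_carrier affine_sym_one by (intro bexI[of _ "[]"]) auto
next
  fix X Y Z assume "X \<in> carrier (affine_sym n)" "Y \<in> carrier (affine_sym n)" "Z \<in> carrier (affine_sym n)"
  then show "X \<otimes>\<^bsub>affine_sym n\<^esub> Y \<otimes>\<^bsub>affine_sym n\<^esub> Z = X \<otimes>\<^bsub>affine_sym n\<^esub> (Y \<otimes>\<^bsub>affine_sym n\<^esub> Z)"
    unfolding affine_sym_carrier using affine_sym_mult affine_sym_append by (metis append_assoc)
next
  fix X assume "X \<in> carrier (affine_sym n)"
  then obtain x where x: "x \<in> words n" "X = cox_rel n `` {x}" by (auto simp: affine_sym_carrier)
  show "\<one>\<^bsub>affine_sym n\<^esub> \<otimes>\<^bsub>affine_sym n\<^esub> X = X"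
    using affine_sym_mult[of "[]" n x] x by (simp add: affine_sym_one)
  have "rev x \<in> words n" using x(1) by auto
  moreover have "cox_rel n `` {rev x @ x} = cox_rel n `` {[]}"
    using cox_rel_rev[OF x(1)] equiv_cox_rel by (metis equiv_class_eq)
  ultimately have "cox_rel n `` {rev x} \<in> carrier (affine_sym n)"
      "cox_rel n `` {rev x} \<otimes>\<^bsub>affine_sym n\<^esub> X = \<one>\<^bsub>affine_sym n\<^esub>"
    using affine_sym_mult[of "rev x" n x] x unfolding affine_sym_carrier affine_sym_one by auto
  then show "\<exists>Y \<in> carrier (affine_sym n). Y \<otimes>\<^bsub>affine_sym n\<^esub> X = \<one>\<^bsub>affine_sym n\<^esub>"
    by blast
qed

lemma cox_gen_closed: "i < n \<Longrightarrow> cox_gen n i \<in> carrier (affine_sym n)"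
  by (auto simp: affine_sym_carrier cox_gen_def intro!: bexI[of _ "[i]"])

lemma cox_class_eq:
  "x \<in> words n \<Longrightarrow> cox_step n x y \<Longrightarrow> cox_rel n `` {x} = cox_rel n `` {y}"
  by (rule equiv_class_eq[OF equiv_cox_rel])
    (use cox_step_words in \<open>auto simp: cox_rel_def simp del: in_lists_conv_set\<close>)

lemma cox_gen_mult:
  "i < n \<Longrightarrow> x \<in> words n \<Longrightarrow>
    cox_gen n i \<otimes>\<^bsub>affine_sym n\<^esub> cox_rel n `` {x} = cox_rel n `` {i # x}"
  using affine_sym_mult[of "[i]" n x] by (simp add: cox_gen_def)

lemma cox_gen_square:
  assumes "i < n" "w \<in> carrier (affine_sym n)"
  shows "cox_gen n i \<otimes>\<^bsub>affine_sym n\<^esub> (cox_gen n i \<otimes>\<^bsub>affine_sym n\<^esub> w) = w"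
proof -
  obtain x where x: "x \<in> words n" "w = cox_rel n `` {x}"
    using assms(2) by (auto simp: affine_sym_carrier)
  have "cox_step n (i # i # x) x" using cox_step.square[OF assms(1), of "[]" x] by simp
  from cox_class_eq[OF _ this] x assms(1) show ?thesis
    by (simp add: cox_gen_mult del: in_lists_conv_set)
qed

lemma cox_gen_braid:
  assumes "i < n" "j = Suc i mod n" "w \<in> carrier (affine_sym n)"
  shows "cox_gen n i \<otimes>\<^bsub>affine_sym n\<^esub> (cox_gen n j \<otimes>\<^bsub>affine_sym n\<^esub> (cox_gen n i \<otimes>\<^bsub>affine_sym n\<^esub> w)) =
         cox_gen n j \<otimes>\<^bsub>affine_sym n\<^esub> (cox_gen n i \<otimes>\<^bsub>affine_sym n\<^esub> (cox_gen n j \<otimes>\<^bsub>affine_sym n\<^esub> w))"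
proof -
  obtain x where x: "x \<in> words n" "w = cox_rel n `` {x}"
    using assms(3) by (auto simp: affine_sym_carrier)
  have j: "j < n" using assms by simp
  have "cox_step n (i # j # i # x) (j # i # j # x)"
    using cox_step.braid[OF assms(1,2), of "[]" x] by simp
  from cox_class_eq[OF _ this] x assms(1) j show ?thesis
    by (simp add: cox_gen_mult del: in_lists_conv_set)
qed

lemma cox_gen_comm:
  assumes "far n i j" "w \<in> carrier (affine_sym n)"
  shows "cox_gen n i \<otimes>\<^bsub>affine_sym n\<^esub> (cox_gen n j \<otimes>\<^bsub>affine_sym n\<^esub> w) =
         cox_gen n j \<otimes>\<^bsub>affine_sym n\<^esub> (cox_gen n i \<otimes>\<^bsub>affine_sym n\<^esub> w)"
proof -
  obtain x where x: "x \<in> words n" "w = cox_rel n `` {x}"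
    using assms(2) by (auto simp: affine_sym_carrier)
  have ij: "i < n" "j < n" using assms(1) by (auto simp: far_def)
  have "cox_step n (i # j # x) (j # i # x)"
    using cox_step.comm[OF assms(1), of "[]" x] by simp
  from cox_class_eq[OF _ this] x ij show ?thesis
    by (simp add: cox_gen_mult del: in_lists_conv_set)
qed

lemma cox_gen_mult_closed:
  "i < n \<Longrightarrow> w \<in> carrier (affine_sym n) \<Longrightarrow> cox_gen n i \<otimes>\<^bsub>affine_sym n\<^esub> w \<in> carrier (affine_sym n)"
  using group_affine_sym cox_gen_closed by (meson group.is_monoid monoid.m_closed)

lemma cox_length_witness:
  assumes "w \<in> carrier (affine_sym n)"
  shows "\<exists>x \<in> words n. length x = cox_length n w \<and> cox_rel n `` {x} = w"
  unfolding cox_length_def by (rule LeastI_ex) (use assms in \<open>auto simp: affine_sym_carrier\<close>)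

lemma cox_length_gen:
  assumes "i < n" "w \<in> carrier (affine_sym n)"
  shows "cox_length n (cox_gen n i \<otimes>\<^bsub>affine_sym n\<^esub> w) \<le> Suc (cox_length n w)"
proof -
  obtain x where x: "x \<in> words n" "length x = cox_length n w" "cox_rel n `` {x} = w"
    using cox_length_witness[OF assms(2)] by auto
  have "cox_length n (cox_gen n i \<otimes>\<^bsub>affine_sym n\<^esub> w) \<le> length (i # x)"
    unfolding cox_length_def
    by (rule Least_le, rule bexI[of _ "i # x"])
      (use cox_gen_mult[OF assms(1) x(1)] x assms(1) in auto)
  with x show ?thesis by simp
qed

lemma decreasing_word_iff:
  assumes "n \<ge> 2"
  shows "decreasing_word n A xs \<longleftrightarrow>
    distinct xs \<and> set xs = A \<and> sorted_wrt (\<lambda>a b. b \<noteq> Suc a mod n) xs"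
proof -
  have irrefl: "a \<noteq> Suc a mod n" for a
    using assms mod_less_divisor[of n "Suc a"] by (cases "a < n") (auto simp: mod_Suc)
  have "(\<forall>p < length xs. \<forall>q < length xs. xs ! p = Suc (xs ! q) mod n \<longrightarrow> p < q) \<longleftrightarrow>
      (\<forall>q p. q < p \<longrightarrow> p < length xs \<longrightarrow> xs ! p \<noteq> Suc (xs ! q) mod n)" (is "?L \<longleftrightarrow> ?R")
  proof
    assume ?L
    then show ?R by (meson order_less_asym order_less_trans)
  next
    assume R: ?R
    show ?L
    proof (intro allI impI)
      fix p q assume "p < length xs" "q < length xs" "xs ! p = Suc (xs ! q) mod n"
      with R irrefl show "p < q" by (cases p q rule: linorder_cases) auto
    qed
  qed
  then show ?thesis by (simp add: decreasing_word_def sorted_wrt_iff_nth_less)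
qed

lemma decreasing_word_exists:
  assumes "n \<ge> 2" "A \<subset> {..<n}"
  shows "\<exists>xs. decreasing_word n A xs"
proof -
  obtain m where m: "m < n" "m \<notin> A" using assms(2) by auto
  define ys where "ys = rev [0..<m] @ rev [Suc m..<n]"
  have "sorted_wrt (\<lambda>a b. b \<noteq> Suc a mod n) (rev [0..<m])"
    unfolding sorted_wrt_rev using m
    by (intro sorted_wrt_mono_rel[OF _ sorted_wrt_upt]) auto
  moreover have "sorted_wrt (\<lambda>a b. b \<noteq> Suc a mod n) (rev [Suc m..<n])"
    unfolding sorted_wrt_rev
    by (intro sorted_wrt_mono_rel[OF _ sorted_wrt_upt]) (auto simp: mod_Suc)
  ultimately have "sorted_wrt (\<lambda>a b. b \<noteq> Suc a mod n) ys"
    using m by (auto simp: ys_def sorted_wrt_append)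
  then have "sorted_wrt (\<lambda>a b. b \<noteq> Suc a mod n) (filter (\<lambda>a. a \<in> A) ys)"
    by (rule sorted_wrt_filter)
  moreover have "distinct (filter (\<lambda>a. a \<in> A) ys)" by (auto simp: ys_def)
  moreover have "set (filter (\<lambda>a. a \<in> A) ys) = A"
  proof -
    have "a \<in> set ys" if "a \<in> A" for a
      using that assms(2) m by (cases a m rule: linorder_cases) (auto simp: ys_def)
    then show ?thesis by auto
  qed
  ultimately show ?thesis using decreasing_word_iff[OF assms(1)] by blast
qed

lemma ring_free_algebra: "ring (free_algebra n)"
proof (rule ringI)
  show "abelian_group (free_algebra n)"
  proof (rule abelian_groupI)
    fix x assume "x \<in> carrier (free_algebra n)"
    then show "\<exists>y \<in> carrier (free_algebra n). y \<oplus>\<^bsub>free_algebra n\<^esub> x = \<zero>\<^bsub>free_algebra n\<^esub>"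
      by (intro bexI[of _ "- x"]) (auto simp: free_algebra_def)
  next
    fix x y assume "x \<in> carrier (free_algebra n)" "y \<in> carrier (free_algebra n)"
    then show "x \<oplus>\<^bsub>free_algebra n\<^esub> y \<in> carrier (free_algebra n)"
      using Poly_Mapping.keys_add[of x y] by (fastforce simp: free_algebra_def)
  qed (auto simp: free_algebra_def add_ac)
  show "monoid (free_algebra n)"
  proof (rule monoidI)
    fix x y assume "x \<in> carrier (free_algebra n)" "y \<in> carrier (free_algebra n)"
    then show "x \<otimes>\<^bsub>free_algebra n\<^esub> y \<in> carrier (free_algebra n)"
      using Poly_Mapping.keys_mult[of x y]
      by (fastforce simp: free_algebra_def plus_free_word_def simp del: in_lists_conv_set)
  qed (auto simp: free_algebra_def mult.assoc zero_free_word_def)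
qed (auto simp: free_algebra_def algebra_simps)

lemma free_var_closed: "i < n \<Longrightarrow> free_var i \<in> carrier (free_algebra n)"
  by (auto simp: free_var_def free_algebra_def)

lemma free_algebra_diff_closed:
  assumes "x \<in> carrier (free_algebra n)" "y \<in> carrier (free_algebra n)"
  shows "x - y \<in> carrier (free_algebra n)"
  using assms Poly_Mapping.keys_diff[of x y] by (fastforce simp: free_algebra_def)

lemma nil_relators_closed: "nil_relators n \<subseteq> carrier (free_algebra n)"
proof -
  have m: "x * y \<in> carrier (free_algebra n)"
    if "x \<in> carrier (free_algebra n)" "y \<in> carrier (free_algebra n)" for x y
    using monoid.m_closed[OF ring.is_monoid[OF ring_free_algebra], OF that]
    by (simp add: free_algebra_def)
  show ?thesis
    by (auto simp: nil_relators_def far_def intro!: m free_algebra_diff_closed free_var_closed)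
qed

lemma ideal_nil_ideal: "ideal (nil_ideal n) (free_algebra n)"
  unfolding nil_ideal_def by (rule ring.genideal_ideal[OF ring_free_algebra nil_relators_closed])

lemma ring_nil_coxeter: "ring (nil_coxeter n)"
  unfolding nil_coxeter_def by (rule ideal.quotient_is_ring[OF ideal_nil_ideal])

lemma nil_proj_hom:
  "(+>\<^bsub>free_algebra n\<^esub>) (nil_ideal n) \<in> ring_hom (free_algebra n) (nil_coxeter n)"
  unfolding nil_coxeter_def by (rule ideal.rcos_ring_hom[OF ideal_nil_ideal])

lemma nil_coxeter_carrier:
  "X \<in> carrier (nil_coxeter n) \<longleftrightarrow>
    (\<exists>p \<in> carrier (free_algebra n). X = nil_ideal n +>\<^bsub>free_algebra n\<^esub> p)"
  by (auto simp: nil_coxeter_def FactRing_def A_RCOSETS_def' a_r_coset_def')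

lemma nil_gen_closed: "i < n \<Longrightarrow> nil_gen n i \<in> carrier (nil_coxeter n)"
  using free_var_closed nil_coxeter_carrier nil_gen_def by blast

lemma nil_word_Nil: "nil_word n [] = \<one>\<^bsub>nil_coxeter n\<^esub>"
  by (simp add: nil_word_def)

lemma nil_word_Cons: "nil_word n (i # x) = nil_gen n i \<otimes>\<^bsub>nil_coxeter n\<^esub> nil_word n x"
  by (simp add: nil_word_def)

lemma nil_word_closed: "x \<in> words n \<Longrightarrow> nil_word n x \<in> carrier (nil_coxeter n)"
proof (induction x)
  case Nil
  show ?case
    using monoid.one_closed[OF ring.is_monoid[OF ring_nil_coxeter]] by (simp add: nil_word_Nil)
next
  case (Cons i x)
  then show ?case
    using monoid.m_closed[OF ring.is_monoid[OF ring_nil_coxeter]] nil_gen_closed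
    by (simp add: nil_word_Cons)
qed

lemma free_algebra_mult: "x \<otimes>\<^bsub>free_algebra n\<^esub> y = x * y"
  by (simp add: free_algebra_def)

lemma nil_gen_comm:
  assumes "far n i j"
  shows "nil_gen n i \<otimes>\<^bsub>nil_coxeter n\<^esub> nil_gen n j = nil_gen n j \<otimes>\<^bsub>nil_coxeter n\<^esub> nil_gen n i"
proof -
  interpret R: ring "free_algebra n" by (rule ring_free_algebra)
  interpret I: ideal "nil_ideal n" "free_algebra n" by (rule ideal_nil_ideal)
  have ij: "free_var i \<in> carrier (free_algebra n)" "free_var j \<in> carrier (free_algebra n)"
    using assms by (auto simp: far_def intro: free_var_closed)
  have "free_var i * free_var j - free_var j * free_var i \<in> nil_ideal n"
    using R.genideal_self[OF nil_relators_closed] assms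
    by (force simp: nil_relators_def nil_ideal_def)
  moreover have "x \<ominus>\<^bsub>free_algebra n\<^esub> y = x - y" if "y \<in> carrier (free_algebra n)" for x y
  proof -
    have "\<ominus>\<^bsub>free_algebra n\<^esub> y = - y"
      by (rule R.minus_equality) (use that in \<open>auto simp: free_algebra_def\<close>)
    then show ?thesis by (simp add: a_minus_def) (simp add: free_algebra_def)
  qed
  ultimately have "free_var i \<otimes>\<^bsub>free_algebra n\<^esub> free_var j \<ominus>\<^bsub>free_algebra n\<^esub>
      free_var j \<otimes>\<^bsub>free_algebra n\<^esub> free_var i \<in> nil_ideal n"
    using R.m_closed[OF ij(2,1)] unfolding free_algebra_mult by presburger
  then have "nil_ideal n +>\<^bsub>free_algebra n\<^esub> (free_var i \<otimes>\<^bsub>free_algebra n\<^esub> free_var j) =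
      nil_ideal n +>\<^bsub>free_algebra n\<^esub> (free_var j \<otimes>\<^bsub>free_algebra n\<^esub> free_var i)"
    using R.quotient_eq_iff_same_a_r_cos[OF ideal_nil_ideal] R.m_closed ij by blast
  then show ?thesis
    using ring_hom_mult[OF nil_proj_hom] ij by (simp add: nil_gen_def)
qed

lemma nil_word_far:
  assumes "\<forall>b \<in> set us. far n b a" "us @ a # vs \<in> words n"
  shows "nil_word n (us @ a # vs) = nil_word n (a # us @ vs)"
  using assms
proof (induction us)
  case (Cons b us)
  interpret U: ring "nil_coxeter n" by (rule ring_nil_coxeter)
  have "nil_gen n b \<otimes>\<^bsub>nil_coxeter n\<^esub> nil_gen n a = nil_gen n a \<otimes>\<^bsub>nil_coxeter n\<^esub> nil_gen n b"
    using Cons.prems by (intro nil_gen_comm) auto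
  moreover have "nil_gen n a \<in> carrier (nil_coxeter n)" "nil_gen n b \<in> carrier (nil_coxeter n)"
    "nil_word n (us @ vs) \<in> carrier (nil_coxeter n)"
    using Cons.prems by (auto intro!: nil_gen_closed nil_word_closed)
  ultimately show ?case using Cons by (simp add: nil_word_Cons flip: U.m_assoc)
qed simp

lemma nil_word_decreasing_unique:
  assumes "n \<ge> 2" "A \<subseteq> {..<n}" "decreasing_word n A xs" "decreasing_word n A ys"
  shows "nil_word n xs = nil_word n ys"
  using assms(2-)
proof (induction xs arbitrary: A ys)
  case Nil
  then show ?case by (simp add: decreasing_word_def)
next
  case (Cons a xs)
  note dec = decreasing_word_iff[OF assms(1)]
  have "a \<in> set ys" using Cons.prems by (auto simp: dec)
  then obtain us vs where ys: "ys = us @ a # vs" by (meson split_list)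
  have "far n b a" if "b \<in> set us" for b
  proof -
    have "b \<in> set xs" using that Cons.prems by (auto simp: dec ys)
    then show ?thesis using that Cons.prems by (auto simp: dec ys far_def sorted_wrt_append)
  qed
  then have "nil_word n ys = nil_word n (a # us @ vs)"
    unfolding ys using Cons.prems by (intro nil_word_far) (auto simp: dec ys)
  moreover have "decreasing_word n (A - {a}) xs" "decreasing_word n (A - {a}) (us @ vs)"
    using Cons.prems by (auto simp: dec ys sorted_wrt_append)
  then have "nil_word n xs = nil_word n (us @ vs)"
    using Cons.IH[of "A - {a}"] Cons.prems(1) by blast
  ultimately show ?case by (simp add: nil_word_Cons)
qed

lemma nil_set_eq:
  assumes "n \<ge> 2" "A \<subseteq> {..<n}" "decreasing_word n A xs"
  shows "nil_set n A = nil_word n xs"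
  unfolding nil_set_def using assms by (metis nil_word_decreasing_unique someI_ex)

lemma nil_set_closed:
  assumes "n \<ge> 2" "A \<subset> {..<n}"
  shows "nil_set n A \<in> carrier (nil_coxeter n)"
proof -
  obtain xs where "decreasing_word n A xs" using decreasing_word_exists[OF assms] by blast
  moreover from this have "xs \<in> words n" using assms by (auto simp: decreasing_word_def)
  ultimately show ?thesis using assms nil_set_eq nil_word_closed by auto
qed

lemma nil_h_closed:
  assumes "n \<ge> 2" "k < n"
  shows "nil_h n k \<in> carrier (nil_coxeter n)"
proof -
  interpret U: ring "nil_coxeter n" by (rule ring_nil_coxeter)
  have "nil_set n A \<in> carrier (nil_coxeter n)" if "A \<subseteq> {..<n}" "card A = k" for A
    using that assms by (intro nil_set_closed) auto
  then show ?thesis unfolding nil_h_def by (intro U.finsum_closed) auto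
qed

lemma nil_h_0:
  assumes "n \<ge> 2"
  shows "nil_h n 0 = \<one>\<^bsub>nil_coxeter n\<^esub>"
proof -
  interpret U: ring "nil_coxeter n" by (rule ring_nil_coxeter)
  have "{A. A \<subseteq> {..<n} \<and> card A = 0} = {{}}" by (auto dest: finite_subset)
  moreover have "nil_set n {} = \<one>\<^bsub>nil_coxeter n\<^esub>"
    using nil_set_eq[OF assms, of "{}" "[]"] by (simp add: decreasing_word_def nil_word_Nil)
  ultimately show ?thesis by (simp add: nil_h_def)
qed

lemma lookup_scale_vec [simp]:
  "Poly_Mapping.lookup (scale_vec c v) w = c * Poly_Mapping.lookup v w"
  by (simp add: scale_vec_def Poly_Mapping.map.rep_eq when_def)

lemma lookup_basis_vec:
  "Poly_Mapping.lookup (basis_vec w) w' = (if w = w' then 1 else 0)"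
  by (simp add: basis_vec_def lookup_single when_def)

lemma scale_vec_simps [simp]:
  "scale_vec 0 v = 0" "scale_vec 1 v = v" "scale_vec c 0 = 0"
  "scale_vec c (scale_vec d v) = scale_vec (c * d) v"
  "scale_vec c (u + v) = scale_vec c u + scale_vec c v"
  "scale_vec (c + d) v = scale_vec c v + scale_vec d v"
  by (auto intro!: poly_mapping_eqI simp: lookup_add algebra_simps)

lemma scale_vec_sum: "scale_vec c (sum f A) = (\<Sum>a\<in>A. scale_vec c (f a))"
  by (induction A rule: infinite_finite_induct) auto

lemma poly_mapping_sum_single:
  fixes p :: "'a \<Rightarrow>\<^sub>0 'b::comm_monoid_add"
  shows "p = (\<Sum>x \<in> Poly_Mapping.keys p. Poly_Mapping.single x (Poly_Mapping.lookup p x))"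
  by (rule poly_mapping_eqI) (auto simp: lookup_sum lookup_single when_def in_keys_iff)

lemma poly_mapping_add_induct [case_names zero single add]:
  fixes p :: "'a \<Rightarrow>\<^sub>0 'b::comm_monoid_add"
  assumes "P 0" and "\<And>x c. P (Poly_Mapping.single x c)" and "\<And>p q. P p \<Longrightarrow> P q \<Longrightarrow> P (p + q)"
  shows "P p"
proof -
  have "P (\<Sum>x \<in> A. Poly_Mapping.single x (Poly_Mapping.lookup p x))" for A
    by (induction A rule: infinite_finite_induct) (auto intro: assms)
  then show ?thesis using poly_mapping_sum_single[of p] by metis
qed

definition linear_op :: "(vec \<Rightarrow> vec) \<Rightarrow> bool" where
  "linear_op f \<longleftrightarrow> (\<forall>u v. f (u + v) = f u + f v) \<and> (\<forall>c v. f (scale_vec c v) = scale_vec c (f v))"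

lemma linear_op_zero: "linear_op f \<Longrightarrow> f 0 = 0"
  by (metis linear_op_def scale_vec_simps(1))

lemma linear_op_sum: "linear_op f \<Longrightarrow> f (sum g A) = (\<Sum>a\<in>A. f (g a))"
  by (induction A rule: infinite_finite_induct) (auto simp: linear_op_zero, auto simp: linear_op_def)

lemma vec_expand: "v = (\<Sum>w \<in> Poly_Mapping.keys v. scale_vec (Poly_Mapping.lookup v w) (basis_vec w))"
  by (rule poly_mapping_eqI) (auto simp: lookup_sum lookup_basis_vec in_keys_iff if_distrib cong: if_cong)

lemma linear_op_eqI:
  assumes "linear_op f" "linear_op g" "v \<in> group_space n"
    and "\<And>w. w \<in> carrier (affine_sym n) \<Longrightarrow> f (basis_vec w) = g (basis_vec w)"
  shows "f v = g v"
proof -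
  have expand: "h v = (\<Sum>w \<in> Poly_Mapping.keys v. scale_vec (Poly_Mapping.lookup v w) (h (basis_vec w)))"
    if "linear_op h" for h
  proof -
    have "h v = h (\<Sum>w \<in> Poly_Mapping.keys v. scale_vec (Poly_Mapping.lookup v w) (basis_vec w))"
      by (rule arg_cong[OF vec_expand])
    also have "\<dots> = (\<Sum>w \<in> Poly_Mapping.keys v. h (scale_vec (Poly_Mapping.lookup v w) (basis_vec w)))"
      by (rule linear_op_sum[OF that])
    finally show ?thesis using that by (simp add: linear_op_def)
  qed
  show ?thesis
    unfolding expand[OF assms(1)] expand[OF assms(2)]
    using assms(3,4) by (intro sum.cong) (auto simp: group_space_def)
qed

lemma gen_act_superset:
  assumes "finite S" "Poly_Mapping.keys v \<subseteq> S"
  shows "gen_act n i v = (\<Sum>w \<in> S.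
     if cox_length n (cox_gen n i \<otimes>\<^bsub>affine_sym n\<^esub> w) > cox_length n w
     then scale_vec (Poly_Mapping.lookup v w) (basis_vec (cox_gen n i \<otimes>\<^bsub>affine_sym n\<^esub> w))
     else 0)"
  unfolding gen_act_def using assms
  by (intro sum.mono_neutral_left) (auto simp: in_keys_iff)

lemma linear_op_gen_act: "linear_op (gen_act n i)"
  unfolding linear_op_def
proof (intro conjI allI)
  fix u v :: vec and c
  let ?S = "Poly_Mapping.keys u \<union> Poly_Mapping.keys v"
  show "gen_act n i (u + v) = gen_act n i u + gen_act n i v"
    using Poly_Mapping.keys_add[of u v]
    by (subst (1 2 3) gen_act_superset[of ?S]) (auto simp: lookup_add simp flip: sum.distrib intro!: sum.cong)
  show "gen_act n i (scale_vec c v) = scale_vec c (gen_act n i v)"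
    by (subst (1 2) gen_act_superset[of "Poly_Mapping.keys v"])
      (auto simp: scale_vec_sum in_keys_iff intro!: sum.cong)
qed

lemma gen_act_basis:
  "gen_act n i (basis_vec w) =
    (if cox_length n (cox_gen n i \<otimes>\<^bsub>affine_sym n\<^esub> w) > cox_length n w
     then basis_vec (cox_gen n i \<otimes>\<^bsub>affine_sym n\<^esub> w) else 0)"
  by (subst gen_act_superset[of "{w}"]) (auto simp: lookup_basis_vec basis_vec_def)

lemma group_space_sum: "(\<And>a. a \<in> A \<Longrightarrow> f a \<in> group_space n) \<Longrightarrow> sum f A \<in> group_space n"
proof (induction A rule: infinite_finite_induct)
  case (insert a A)
  then have "f a \<in> group_space n" "sum f A \<in> group_space n" by auto
  then show ?case using insert Poly_Mapping.keys_add[of "f a" "sum f A"]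
    by (auto simp: group_space_def)
qed (auto simp: group_space_def)

lemma group_space_zero: "0 \<in> group_space n"
  by (simp add: group_space_def)

lemma group_space_keys: "v \<in> group_space n \<Longrightarrow> w \<in> Poly_Mapping.keys v \<Longrightarrow> w \<in> carrier (affine_sym n)"
  by (auto simp: group_space_def)

lemma group_space_scale: "v \<in> group_space n \<Longrightarrow> scale_vec c v \<in> group_space n"
  by (auto simp: group_space_def in_keys_iff)

lemma basis_vec_closed: "w \<in> carrier (affine_sym n) \<Longrightarrow> basis_vec w \<in> group_space n"
  by (simp add: basis_vec_def group_space_def)

lemma gen_act_closed: "i < n \<Longrightarrow> v \<in> group_space n \<Longrightarrow> gen_act n i v \<in> group_space n"
  unfolding gen_act_def
  by (intro group_space_sum)
    (auto intro!: group_space_scale basis_vec_closed cox_gen_mult_closed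
      intro: group_space_keys group_space_zero)

lemma word_act_closed:
  "x \<in> words n \<Longrightarrow> v \<in> group_space n \<Longrightarrow> foldr (gen_act n) x v \<in> group_space n"
  by (induction x) (auto intro: gen_act_closed)

lemma linear_op_comp: "linear_op f \<Longrightarrow> linear_op g \<Longrightarrow> linear_op (\<lambda>v. f (g v))"
  by (simp add: linear_op_def)

lemma linear_op_word_act: "linear_op (foldr (gen_act n) x)"
proof (induction x)
  case Nil
  show ?case by (simp add: linear_op_def)
next
  case (Cons i x)
  show ?case using linear_op_comp[OF linear_op_gen_act Cons] by (simp add: comp_def)
qed

lemma free_act_superset:
  assumes "finite S" "Poly_Mapping.keys p \<subseteq> S"
  shows "free_act n p v =
    (\<Sum>x \<in> S. scale_vec (Poly_Mapping.lookup p x) (foldr (gen_act n) (letters x) v))"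
  unfolding free_act_def using assms by (intro sum.mono_neutral_left) (auto simp: in_keys_iff)

lemma free_act_add: "free_act n (p + q) v = free_act n p v + free_act n q v"
  using Poly_Mapping.keys_add[of p q]
  by (subst (1 2 3) free_act_superset[of "Poly_Mapping.keys p \<union> Poly_Mapping.keys q"])
    (auto simp: lookup_add simp flip: sum.distrib)

lemma free_act_zero [simp]: "free_act n 0 v = 0"
  by (simp add: free_act_def)

lemma free_act_single: "free_act n (Poly_Mapping.single x c) v = scale_vec c (foldr (gen_act n) (letters x) v)"
  by (subst free_act_superset[of "{x}"]) auto

lemma free_act_diff: "free_act n (p - q) v = free_act n p v - free_act n q v"
  using free_act_add[of n "p - q" q v] by (simp add: algebra_simps)

lemma linear_op_free_act: "linear_op (free_act n p)"
proof (induction p rule: poly_mapping_add_induct)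
  case (single x c)
  show ?case using linear_op_word_act[of n "letters x"]
    by (simp add: linear_op_def free_act_single mult.commute)
qed (auto simp: linear_op_def free_act_add add_ac)

lemma free_act_mult: "free_act n (p * q) v = free_act n p (free_act n q v)"
proof (induction p rule: poly_mapping_add_induct)
  case zero
  show ?case by simp
next
  case (add p p')
  then show ?case by (simp add: distrib_right free_act_add)
next
  case (single x c)
  show ?case
  proof (induction q rule: poly_mapping_add_induct)
    case zero
    show ?case by (simp add: linear_op_zero[OF linear_op_free_act])
  next
    case (add q q')
    then show ?case
      using linear_op_free_act[of n "Poly_Mapping.single x c"]
      by (simp add: distrib_left free_act_add linear_op_def)
  next
    case (single y d)
    show ?case
      using linear_op_word_act[of n "letters x"]
      by (simp add: mult_single free_act_single plus_free_word_def linear_op_def)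
  qed
qed

lemma free_act_one: "free_act n 1 v = v"
  by (simp add: free_act_single zero_free_word_def flip: single_one)

lemma free_act_var: "free_act n (free_var i) v = gen_act n i v"
  by (simp add: free_act_single free_var_def)

lemma free_act_closed:
  "p \<in> carrier (free_algebra n) \<Longrightarrow> v \<in> group_space n \<Longrightarrow> free_act n p v \<in> group_space n"
  unfolding free_act_def free_algebra_def
  by (intro group_space_sum group_space_scale word_act_closed) auto

lemma gen_act_square:
  assumes "i < n" "v \<in> group_space n"
  shows "gen_act n i (gen_act n i v) = 0"
proof (rule linear_op_eqI[OF _ _ assms(2)])
  fix w assume "w \<in> carrier (affine_sym n)"
  then show "gen_act n i (gen_act n i (basis_vec w)) = 0"
    using cox_gen_square[OF assms(1)] linear_op_zero[OF linear_op_gen_act]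
    by (simp add: gen_act_basis)
qed (use linear_op_gen_act in \<open>auto simp: linear_op_def\<close>)

lemma gen_act_braid:
  assumes "i < n" "j = Suc i mod n" "v \<in> group_space n"
  shows "gen_act n i (gen_act n j (gen_act n i v)) = gen_act n j (gen_act n i (gen_act n j v))"
proof (rule linear_op_eqI[OF _ _ assms(3)])
  fix w assume w: "w \<in> carrier (affine_sym n)"
  have j: "j < n" using assms by simp
  let ?m = "\<lambda>i w. cox_gen n i \<otimes>\<^bsub>affine_sym n\<^esub> w" and ?l = "cox_length n"
  have 1: "gen_act n a (gen_act n b (gen_act n c (basis_vec w))) =
      (if ?l (?m a (?m b (?m c w))) = ?l w + 3 then basis_vec (?m a (?m b (?m c w))) else 0)"
    if "a < n" "b < n" "c < n" for a b c
  proof -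
    have "?l (?m c w) \<le> Suc (?l w)" "?l (?m b (?m c w)) \<le> Suc (?l (?m c w))"
      "?l (?m a (?m b (?m c w))) \<le> Suc (?l (?m b (?m c w)))"
      using that w by (auto intro!: cox_length_gen cox_gen_mult_closed)
    then show ?thesis
      by (auto simp: gen_act_basis linear_op_zero[OF linear_op_gen_act])
  qed
  show "gen_act n i (gen_act n j (gen_act n i (basis_vec w))) =
        gen_act n j (gen_act n i (gen_act n j (basis_vec w)))"
    using assms(1) j cox_gen_braid[OF assms(1,2) w] by (simp add: 1)
qed (use linear_op_gen_act in \<open>auto simp: linear_op_def\<close>)

lemma gen_act_comm:
  assumes "far n i j" "v \<in> group_space n"
  shows "gen_act n i (gen_act n j v) = gen_act n j (gen_act n i v)"
proof (rule linear_op_eqI[OF _ _ assms(2)])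
  fix w assume w: "w \<in> carrier (affine_sym n)"
  have ij: "i < n" "j < n" using assms by (auto simp: far_def)
  let ?m = "\<lambda>i w. cox_gen n i \<otimes>\<^bsub>affine_sym n\<^esub> w" and ?l = "cox_length n"
  have 1: "gen_act n a (gen_act n b (basis_vec w)) =
      (if ?l (?m a (?m b w)) = ?l w + 2 then basis_vec (?m a (?m b w)) else 0)"
    if "a < n" "b < n" for a b
  proof -
    have "?l (?m b w) \<le> Suc (?l w)" "?l (?m a (?m b w)) \<le> Suc (?l (?m b w))"
      using that w by (auto intro!: cox_length_gen cox_gen_mult_closed)
    then show ?thesis
      by (auto simp: gen_act_basis linear_op_zero[OF linear_op_gen_act])
  qed
  show "gen_act n i (gen_act n j (basis_vec w)) = gen_act n j (gen_act n i (basis_vec w))"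
    using ij cox_gen_comm[OF assms(1) w] by (simp add: 1)
qed (use linear_op_gen_act in \<open>auto simp: linear_op_def\<close>)

lemma nil_ideal_act:
  assumes "p \<in> nil_ideal n" "v \<in> group_space n"
  shows "free_act n p v = 0"
proof -
  let ?R = "free_algebra n"
  interpret R: ring ?R by (rule ring_free_algebra)
  define J where "J = {p \<in> carrier ?R. \<forall>v \<in> group_space n. free_act n p v = 0}"
  have minus: "\<ominus>\<^bsub>?R\<^esub> y = - y" if "y \<in> carrier ?R" for y
    by (rule R.minus_equality) (use that in \<open>auto simp: free_algebra_def\<close>)
  have add: "x \<oplus>\<^bsub>?R\<^esub> y = x + y" "\<zero>\<^bsub>?R\<^esub> = 0" for x y by (simp_all add: free_algebra_def)
  have "ideal J ?R"
  proof (rule idealI[OF ring_free_algebra])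
    show "subgroup J (add_monoid ?R)"
    proof (rule group.subgroupI[OF R.a_group])
      show "J \<noteq> {}" using R.zero_closed add(2) by (auto simp: J_def)
    next
      fix a assume a: "a \<in> J"
      then have "\<ominus>\<^bsub>?R\<^esub> a \<in> J"
        using R.a_inv_closed[of a] free_act_diff[of n 0 a] by (auto simp: J_def minus)
      then show "inv\<^bsub>add_monoid ?R\<^esub> a \<in> J" by (simp add: a_inv_def)
    next
      fix a b assume "a \<in> J" "b \<in> J"
      then have "a \<oplus>\<^bsub>?R\<^esub> b \<in> J"
        using R.a_closed[of a b] by (auto simp: J_def add free_act_add)
      then show "a \<otimes>\<^bsub>add_monoid ?R\<^esub> b \<in> J" by simp
    qed (auto simp: J_def)
  next
    fix a x assume ax: "a \<in> J" "x \<in> carrier ?R"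
    then show "x \<otimes>\<^bsub>?R\<^esub> a \<in> J"
      using R.m_closed[of x a]
      by (auto simp: J_def free_algebra_mult free_act_mult linear_op_zero[OF linear_op_free_act])
    show "a \<otimes>\<^bsub>?R\<^esub> x \<in> J"
      using ax R.m_closed[of a x] by (auto simp: J_def free_algebra_mult free_act_mult free_act_closed)
  qed
  moreover have "nil_relators n \<subseteq> J"
  proof
    fix p assume p: "p \<in> nil_relators n"
    then have "p \<in> carrier ?R" using nil_relators_closed by blast
    moreover have "free_act n p v = 0" if "v \<in> group_space n" for v
      using p that unfolding nil_relators_def
      by (auto simp: free_act_diff free_act_mult free_act_var gen_act_square
        intro: gen_act_braid gen_act_comm)
    ultimately show "p \<in> J" by (simp add: J_def)
  qed
  ultimately have "nil_ideal n \<subseteq> J" by (auto simp: nil_ideal_def genideal_def)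
  with assms show ?thesis by (auto simp: J_def)
qed

lemma nil_act_coset:
  assumes "p \<in> carrier (free_algebra n)" "v \<in> group_space n"
  shows "nil_act n (nil_ideal n +>\<^bsub>free_algebra n\<^esub> p) v = free_act n p v"
proof -
  interpret I: ideal "nil_ideal n" "free_algebra n" by (rule ideal_nil_ideal)
  let ?X = "nil_ideal n +>\<^bsub>free_algebra n\<^esub> p"
  have "(SOME q. q \<in> ?X) \<in> ?X" using I.a_rcos_self[OF assms(1)] by (rule someI)
  then obtain h where "h \<in> nil_ideal n" "(SOME q. q \<in> ?X) = h \<oplus>\<^bsub>free_algebra n\<^esub> p"
    by (auto simp: a_r_coset_def')
  then have "h \<in> nil_ideal n" "(SOME q. q \<in> ?X) = h + p" by (auto simp: free_algebra_def)
  then show ?thesis using nil_ideal_act assms(2) by (simp add: nil_act_def free_act_add)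
qed

lemma nil_act_closed:
  "X \<in> carrier (nil_coxeter n) \<Longrightarrow> v \<in> group_space n \<Longrightarrow> nil_act n X v \<in> group_space n"
  by (auto simp: nil_coxeter_carrier nil_act_coset free_act_closed)

lemma nil_act_mult:
  assumes "X \<in> carrier (nil_coxeter n)" "Y \<in> carrier (nil_coxeter n)" "v \<in> group_space n"
  shows "nil_act n (X \<otimes>\<^bsub>nil_coxeter n\<^esub> Y) v = nil_act n X (nil_act n Y v)"
proof -
  interpret R: ring "free_algebra n" by (rule ring_free_algebra)
  obtain p q where pq: "p \<in> carrier (free_algebra n)" "q \<in> carrier (free_algebra n)"
    "X = nil_ideal n +>\<^bsub>free_algebra n\<^esub> p" "Y = nil_ideal n +>\<^bsub>free_algebra n\<^esub> q"
    using assms by (auto simp: nil_coxeter_carrier)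
  then have "X \<otimes>\<^bsub>nil_coxeter n\<^esub> Y = nil_ideal n +>\<^bsub>free_algebra n\<^esub> (p \<otimes>\<^bsub>free_algebra n\<^esub> q)"
    using ring_hom_mult[OF nil_proj_hom] by simp
  with pq assms(3) show ?thesis
    using R.m_closed[OF pq(1,2)]
    by (simp add: nil_act_coset free_act_closed free_algebra_mult free_act_mult)
qed

lemma nil_act_one:
  assumes "v \<in> group_space n"
  shows "nil_act n \<one>\<^bsub>nil_coxeter n\<^esub> v = v"
proof -
  interpret R: ring "free_algebra n" by (rule ring_free_algebra)
  have "nil_act n \<one>\<^bsub>nil_coxeter n\<^esub> v = free_act n \<one>\<^bsub>free_algebra n\<^esub> v"
    using nil_act_coset[OF R.one_closed assms] ring_hom_one[OF nil_proj_hom] by simp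
  then show ?thesis by (simp add: free_act_one free_algebra_def)
qed

lemma nil_act_gen:
  "i < n \<Longrightarrow> v \<in> group_space n \<Longrightarrow> nil_act n (nil_gen n i) v = gen_act n i v"
  by (simp add: nil_gen_def nil_act_coset free_var_closed free_act_var)

lemma nil_h_0_act: "n \<ge> 2 \<Longrightarrow> v \<in> group_space n \<Longrightarrow> nil_act n (nil_h n 0) v = v"
  by (simp add: nil_h_0 nil_act_one)

lemma stanley_coeff_append_zeros:
  assumes "n \<ge> 2" "\<forall>a \<in> set as. a < n"
  shows "stanley_coeff n w (as @ replicate k 0) = stanley_coeff n w as"
proof -
  let ?v = "fold (\<lambda>a. nil_act n (nil_h n a)) as (basis_vec \<one>\<^bsub>affine_sym n\<^esub>)"
  have "v \<in> group_space n \<Longrightarrow> fold (\<lambda>a. nil_act n (nil_h n a)) as v \<in> group_space n" for v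
    using assms by (induction as arbitrary: v) (auto intro: nil_act_closed nil_h_closed)
  moreover have "\<one>\<^bsub>affine_sym n\<^esub> \<in> carrier (affine_sym n)"
    by (simp add: group.is_monoid group_affine_sym monoid.one_closed)
  ultimately have "?v \<in> group_space n" by (simp add: basis_vec_closed)
  then have "fold (\<lambda>a. nil_act n (nil_h n a)) (replicate k 0) ?v = ?v"
    using nil_h_0_act[OF assms(1)] by (induction k) auto
  then show ?thesis by (simp add: stanley_coeff_def)
qed

lemma affine_stanley_nth:
  assumes "n \<ge> 2" "\<forall>a \<in> set as. a \<le> n - 1"
  shows "affine_stanley n w (Poly_Mapping.nth as) = stanley_coeff n w as"
proof -
  let ?d = "Poly_Mapping.degree (Poly_Mapping.nth as :: nat \<Rightarrow>\<^sub>0 nat)"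
  let ?bs = "map (Poly_Mapping.lookup (Poly_Mapping.nth as)) [0..<?d]"
  have le: "nth_default 0 as i \<le> n - 1" for i
    using assms(2) by (auto simp: nth_default_def)
  have zero: "nth_default 0 as i = 0" if "i \<ge> ?d" for i
    using that beyond_degree_lookup_zero[of "Poly_Mapping.nth as" i] by simp
  have d: "?d \<le> length as"
  proof (rule ccontr)
    assume "\<not> ?d \<le> length as"
    then have "?d - 1 \<in> Poly_Mapping.keys (Poly_Mapping.nth as :: nat \<Rightarrow>\<^sub>0 nat)" "?d - 1 \<ge> length as"
      using degree_greater_zero_in_keys[of "Poly_Mapping.nth as :: nat \<Rightarrow>\<^sub>0 nat"] by auto
    then show False by (auto simp: in_keys_iff nth_default_def simp del: keys_nth)
  qed
  have "as = ?bs @ replicate (length as - ?d) 0"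
  proof (rule nth_equalityI)
    fix i assume "i < length as"
    then show "as ! i = (?bs @ replicate (length as - ?d) 0) ! i"
      using zero[of i] by (auto simp: nth_append nth_default_def)
  qed (use d in auto)
  moreover have "\<forall>a \<in> set ?bs. a < n"
    using le assms(1) by (auto intro!: le_less_trans[OF le])
  ultimately have "stanley_coeff n w as = stanley_coeff n w ?bs"
    using stanley_coeff_append_zeros[OF assms(1), of ?bs w "length as - ?d"] by simp
  with le show ?thesis by (simp add: affine_stanley_def)
qed

end

(* The operators by which the u_i act satisfy the nilCoxeter relations, so it is enough to show that
   the h_k commute in every ring with such elements u_i; the coefficients of the affine Stanley
   function then depend only on the multiset of exponents.

   Group the terms u_A u_B of h_a h_b by the union of A and B. Over subsets of a fixed proper subset S
   of the cycle the generating function of the u_A is a product of factors 1 + x u_i, and such products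
   commute for different x by the Yang-Baxter equation (Fomin and Stanley). Moebius inversion then gives
   symmetry of the sum over all pairs with a given proper union.

   If A and B cover the cycle, walk upwards from an element of A - B: there is a run b, b+1, ..., b+k+1
   with b in A - B, the inner elements in both sets and b+k+1 in B - A. Fix a nonempty set of such
   runs; let P consist of their elements in A, Q of their elements in B, and I of all remaining
   indices. Then u_A = u_P u_{A Int I}, u_B = u_{B Int I} u_Q and |P| = |Q|, which reduces the sum over
   these pairs to the proper subset I. A second Moebius inversion, over the sets of runs, finishes
   the proof. *)
theory Submission
  imports Defs "HOL-Computational_Algebra.Formal_Power_Series" "HOL-Number_Theory.Cong"
begin

section \<open>The ring generated by the nilCoxeter relations\<close>

text \<open>The relations are imposed on elements of a type-class ring, so that library sums,
  products and formal power series apply to them. The instance used later is a ring of linear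
  operators, not the quotient \<open>nil_coxeter n\<close>.\<close>

locale nil_coxeter_relations =
  fixes n :: nat and u :: "nat \<Rightarrow> 'a::ring_1"
  assumes n_ge_3: "n \<ge> 3"
    and square: "i < n \<Longrightarrow> u i * u i = 0"
    and braid: "i < n \<Longrightarrow> j = Suc i mod n \<Longrightarrow> u i * u j * u i = u j * u i * u j"
    and comm: "far n i j \<Longrightarrow> u i * u j = u j * u i"
begin

lemma n_ge_2: "n \<ge> 2"
  using n_ge_3 by simp

definition word_prod :: "nat list \<Rightarrow> 'a" where
  "word_prod xs = prod_list (map u xs)"

definition set_prod :: "nat set \<Rightarrow> 'a" where
  "set_prod A = word_prod (SOME xs. decreasing_word n A xs)"

lemma word_prod_simps [simp]:
  "word_prod [] = 1" "word_prod (i # xs) = u i * word_prod xs"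
  "word_prod (xs @ ys) = word_prod xs * word_prod ys"
  by (simp_all add: word_prod_def)

lemma word_prod_far:
  assumes "\<And>b. b \<in> set xs \<Longrightarrow> far n b a"
  shows "word_prod xs * u a = u a * word_prod xs"
  using assms
proof (induction xs)
  case (Cons b xs)
  then have "u b * u a = u a * u b" "word_prod xs * u a = u a * word_prod xs"
    by (auto intro: comm)
  then show ?case by (metis mult.assoc word_prod_simps(2))
qed simp

text \<open>The first letter \<open>a\<close> of \<open>xs\<close> also occurs in \<open>ys\<close>.
  A letter in front of it there comes after \<open>a\<close> in \<open>xs\<close>, so it is neither
  the successor nor the predecessor of \<open>a\<close>. Hence \<open>a\<close> commutes to the
  front of \<open>ys\<close>, and induction applies to the remaining letters.\<close>

lemma word_prod_decreasing_unique:
  assumes "A \<subseteq> {..<n}" "decreasing_word n A xs" "decreasing_word n A ys"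
  shows "word_prod xs = word_prod ys"
  using assms
proof (induction xs arbitrary: A ys)
  case Nil
  then show ?case by (simp add: decreasing_word_def)
next
  case (Cons a xs)
  note dec = decreasing_word_iff[OF n_ge_2]
  have "a \<in> set ys" using Cons.prems by (auto simp: dec)
  then obtain us vs where ys: "ys = us @ a # vs" by (meson split_list)
  have "far n b a" if "b \<in> set us" for b
  proof -
    have "b \<in> set xs" using that Cons.prems by (auto simp: dec ys)
    then show ?thesis using that Cons.prems by (auto simp: dec ys far_def sorted_wrt_append)
  qed
  then have "word_prod ys = u a * word_prod (us @ vs)"
    by (simp add: ys word_prod_far flip: mult.assoc)
  moreover have "decreasing_word n (A - {a}) xs" "decreasing_word n (A - {a}) (us @ vs)"
    using Cons.prems by (auto simp: dec ys sorted_wrt_append)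
  then have "word_prod xs = word_prod (us @ vs)"
    using Cons.IH[of "A - {a}"] Cons.prems(1) by blast
  ultimately show ?case by simp
qed

lemma set_prod_eq:
  "A \<subseteq> {..<n} \<Longrightarrow> decreasing_word n A xs \<Longrightarrow> set_prod A = word_prod xs"
  unfolding set_prod_def by (metis word_prod_decreasing_unique someI_ex)

lemma set_prod_empty [simp]: "set_prod {} = 1"
  using set_prod_eq[of "{}" "[]"] by (simp add: decreasing_word_def)

lemma set_prod_singleton: "i < n \<Longrightarrow> set_prod {i} = u i"
  using set_prod_eq[of "{i}" "[i]"] n_ge_2 by (simp add: decreasing_word_iff)

text \<open>The last assumption is exactly what keeps the concatenation of a decreasing word of
  \<open>A\<close> with one of \<open>B\<close> decreasing.\<close>

lemma set_prod_union:
  assumes "A \<union> B \<subset> {..<n}" "A \<inter> B = {}" "\<And>i. i \<in> A \<Longrightarrow> Suc i mod n \<notin> B"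
  shows "set_prod (A \<union> B) = set_prod A * set_prod B"
proof -
  have AB: "A \<subset> {..<n}" "B \<subset> {..<n}" using assms(1) by auto
  obtain xs ys where xs: "decreasing_word n A xs" and ys: "decreasing_word n B ys"
    using decreasing_word_exists[OF n_ge_2] AB by metis
  then have "decreasing_word n (A \<union> B) (xs @ ys)"
    using assms(2,3) by (auto simp: decreasing_word_iff[OF n_ge_2] sorted_wrt_append)
  then have "set_prod (A \<union> B) = word_prod (xs @ ys)"
    using assms(1) by (intro set_prod_eq) auto
  with xs ys AB show ?thesis by (simp add: set_prod_eq psubset_imp_subset)
qed

lemma set_prod_far:
  assumes "A \<subset> {..<n}" "\<And>b. b \<in> A \<Longrightarrow> far n b a"
  shows "set_prod A * u a = u a * set_prod A"
proof -
  obtain xs where "decreasing_word n A xs"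
    using decreasing_word_exists[OF n_ge_2 assms(1)] by blast
  then show ?thesis
    using assms word_prod_far[of xs a] by (auto simp: set_prod_eq decreasing_word_def)
qed

text \<open>For \<open>S = {..<n}\<close> and \<open>k < n\<close> this is the element h_k. Proper
  subsets \<open>S\<close> serve the induction along the cycle and the inversion over
  unions.\<close>

definition h_on :: "nat set \<Rightarrow> nat \<Rightarrow> 'a" where
  "h_on S k = (\<Sum>A | A \<subseteq> S \<and> card A = k. set_prod A)"

end

text \<open>Both sides expand to the same linear terms and the same multiples of
  \<open>u * v\<close> and \<open>v * u\<close>. Terms with a square vanish, and the cubic terms
  agree by the braid relation.\<close>

lemma yang_baxter:
  fixes u v s t :: "'a::ring_1"
  assumes "u * u = 0" "v * v = 0" "v * u * v = u * v * u"
    and s: "\<And>r. r * s = s * r" and t: "\<And>r. r * t = t * r"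
  shows "(1 + s * v) * (1 + (s + t) * u) * (1 + t * v) =
         (1 + t * u) * (1 + (s + t) * v) * (1 + s * u)"
proof -
  have sl: "r * (s * q) = s * (r * q)" for r q by (metis mult.assoc s)
  have tl: "r * (t * q) = t * (r * q)" for r q by (metis mult.assoc t)
  have q: "u * (u * r) = 0" "v * (v * r) = 0" for r using assms(1,2) by (simp_all flip: mult.assoc)
  have b: "v * (u * v) = u * (v * u)" using assms(3) by (simp add: mult.assoc)
  have st: "t * (s * q) = s * (t * q)" for q by (rule sl)
  show ?thesis
    by (simp add: distrib_left distrib_right mult.assoc assms(1,2) b q s[of u] s[of v] t[of u] t[of v]
      sl[of u] sl[of v] tl[of u] tl[of v] st)
qed

section \<open>Commutation over a proper subset of the cycle\<close>

text \<open>The induction step for the commutation of generating functions: \<open>u\<close> belongs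
  to the new top element, \<open>v\<close> to its predecessor, \<open>p\<close> and \<open>q\<close>
  to the remaining elements, and \<open>swap\<close> is the induction hypothesis. The factor in
  \<open>v\<close> is moved across by its inverse, after which the Yang-Baxter equation exchanges
  the factors in \<open>u\<close>.\<close>

lemma yang_baxter_swap:
  fixes u v s t :: "'a::ring_1"
  assumes sq: "u * u = 0" "v * v = 0" and braid: "v * u * v = u * v * u"
    and s: "\<And>r. r * s = s * r" and t: "\<And>r. r * t = t * r"
    and comm: "p * u = u * p" "q * u = u * q"
    and swap: "(1 + s * v) * p * ((1 + t * v) * q) = (1 + t * v) * q * ((1 + s * v) * p)"
  shows "(1 + s * u) * ((1 + s * v) * p) * ((1 + t * u) * ((1 + t * v) * q)) =
         (1 + t * u) * ((1 + t * v) * q) * ((1 + s * u) * ((1 + s * v) * p))"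
proof -
  have cen: "r * (1 + a * u) = (1 + a * u) * r" if "r * u = u * r" "\<And>r. r * a = a * r" for r a :: 'a
  proof -
    have "r * (a * u) = a * u * r" using that by (metis mult.assoc)
    then show ?thesis by (simp add: distrib_left distrib_right)
  qed
  have e: "(1 + a * w) * (1 + b * w) = 1 + (a + b) * w" if "w * w = 0" "\<And>r. r * b = b * r" for a b w :: 'a
  proof -
    have "a * w * (b * w) = a * (w * b) * w" by (simp add: mult.assoc)
    also have "\<dots> = a * (b * w) * w" by (simp only: that(2))
    also have "\<dots> = a * b * (w * w)" by (simp add: mult.assoc)
    finally have "a * w * (b * w) = a * b * (w * w)" .
    with that show ?thesis by (simp add: distrib_left distrib_right add_ac)
  qed
  have ts: "r * (t - s) = (t - s) * r" for r using s t by (simp add: algebra_simps)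
  \<comment> \<open>Since \<open>v * v = 0\<close>, the factors behave like exponentials in the
    parameter: the parameters add up, and negation inverts.\<close>
  have inv: "(1 + - s * v) * (1 + s * v) = 1" using e[of v s "- s"] sq s by simp
  have "p * ((1 + t * v) * q) = (1 + - s * v) * ((1 + s * v) * p * ((1 + t * v) * q))"
    using inv by (simp flip: mult.assoc)
  also have "\<dots> = (1 + - s * v) * (1 + t * v) * (q * ((1 + s * v) * p))"
    unfolding swap by (simp add: mult.assoc)
  also have "(1 + - s * v) * (1 + t * v) = 1 + (t - s) * v"
    using e[of v t "- s"] sq t by (simp add: algebra_simps)
  finally have p: "p * ((1 + t * v) * q) = (1 + (t - s) * v) * (q * ((1 + s * v) * p))" .
  \<comment> \<open>The outer parameters are \<open>s\<close> and \<open>t - s\<close>, so that the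
    middle one is \<open>t\<close>.\<close>
  have yb: "(1 + s * v) * (1 + t * u) * (1 + (t - s) * v) =
      (1 + (t - s) * u) * (1 + t * v) * (1 + s * u)"
    using yang_baxter[OF sq braid s ts] by simp
  have "(1 + s * u) * ((1 + s * v) * p) * ((1 + t * u) * ((1 + t * v) * q)) =
      (1 + s * u) * ((1 + s * v) * (1 + t * u) * (p * ((1 + t * v) * q)))"
    using cen[OF comm(1) t] by (simp only: mult.assoc) (simp only: flip: mult.assoc)
  also have "\<dots> = (1 + s * u) * ((1 + s * v) * (1 + t * u) * (1 + (t - s) * v)) *
      (q * ((1 + s * v) * p))"
    by (simp only: p mult.assoc)
  also have "\<dots> = (1 + s * u) * (1 + (t - s) * u) * ((1 + t * v) * ((1 + s * u) * q) * ((1 + s * v) * p))"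
    unfolding yb by (simp only: mult.assoc)
  also have "(1 + s * u) * (1 + (t - s) * u) = 1 + t * u"
    using e[OF sq(1) ts, of s] by simp
  also have "(1 + s * u) * q = q * (1 + s * u)" using cen[OF comm(2) s] by simp
  finally show ?thesis by (simp only: mult.assoc)
qed

context nil_coxeter_relations
begin

lemma h_on_empty: "h_on {} k = (if k = 0 then 1 else 0)"
proof -
  have eq: "{A. A \<subseteq> {} \<and> card A = k} = (if k = 0 then {{}} else {})"
    by auto
  show ?thesis unfolding h_on_def eq by simp
qed

text \<open>As the successor of \<open>m\<close> is absent, \<open>u m\<close> can be taken as the
  first factor in the product of every subset that contains \<open>m\<close>.\<close>

lemma h_on_insert:
  assumes S: "insert m S \<subset> {..<n}" and m: "m \<notin> S" "Suc m mod n \<notin> S"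
  shows "h_on (insert m S) k = h_on S k + (if k = 0 then 0 else u m * h_on S (k - 1))"
proof -
  have fin: "finite S" using S finite_subset[of S "{..<n}"] by auto
  have finA: "finite A" if "A \<subseteq> S" for A using that fin finite_subset by blast
  have "{A. A \<subseteq> insert m S \<and> card A = k} =
      {A. A \<subseteq> S \<and> card A = k} \<union> insert m ` {A. A \<subseteq> S \<and> Suc (card A) = k}" (is "_ = ?X \<union> insert m ` ?Y")
  proof (intro Set.set_eqI iffI)
    fix A assume A: "A \<in> {A. A \<subseteq> insert m S \<and> card A = k}"
    show "A \<in> ?X \<union> insert m ` ?Y"
    proof (cases "m \<in> A")
      case True
      have "A - {m} \<subseteq> S" using A by auto
      moreover have "card A = Suc (card (A - {m}))"
        using True finA[OF calculation] by (metis card_Suc_Diff1 finite_Diff2 finite.emptyI finite_insert)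
      ultimately have "A = insert m (A - {m})" "A - {m} \<in> ?Y" using True A by auto
      then show ?thesis by blast
    qed (use A in auto)
  qed (use m finA in \<open>auto simp: card_insert_if\<close>)
  moreover have "?X \<inter> insert m ` ?Y = {}" using m by auto
  moreover have "finite ?X" "finite ?Y" using fin by auto
  ultimately have "h_on (insert m S) k = h_on S k + sum set_prod (insert m ` ?Y)"
    unfolding h_on_def by (simp add: sum.union_disjoint)
  also have "sum set_prod (insert m ` ?Y) = (\<Sum>A\<in>?Y. set_prod (insert m A))"
    using m by (intro sum.reindex_cong[of "insert m"]) (auto simp: inj_on_def)
  also have "\<dots> = (\<Sum>A\<in>?Y. u m * set_prod A)"
  proof (intro sum.cong refl)
    fix A assume A: "A \<in> ?Y"
    have "{m} \<union> A \<subset> {..<n}"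
      by (rule subset_psubset_trans[OF _ S]) (use A in auto)
    moreover have "m \<notin> A" "Suc m mod n \<notin> A" using A m by auto
    ultimately have "set_prod ({m} \<union> A) = set_prod {m} * set_prod A"
      by (intro set_prod_union) auto
    then show "set_prod (insert m A) = u m * set_prod A"
      using S set_prod_singleton[of m] by auto
  qed
  also have "\<dots> = (if k = 0 then 0 else u m * h_on S (k - 1))"
    by (cases k) (auto simp: h_on_def sum_distrib_left)
  finally show ?thesis .
qed

lemma h_on_far:
  assumes "S \<subset> {..<n}" "\<And>b. b \<in> S \<Longrightarrow> far n b m"
  shows "h_on S k * u m = u m * h_on S k"
  unfolding h_on_def sum_distrib_left sum_distrib_right
  using assms by (intro sum.cong refl set_prod_far) auto

lemma exists_top:
  assumes "S \<subset> {..<n}" "S \<noteq> {}"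
  shows "\<exists>m\<in>S. Suc m mod n \<notin> S"
proof (rule ccontr)
  assume "\<not> ?thesis"
  then have step: "Suc m mod n \<in> S" if "m \<in> S" for m using that by blast
  obtain m where m: "m \<in> S" "m < n" using assms by auto
  have "(m + k) mod n \<in> S" for k
  proof (induction k)
    case (Suc k)
    then show ?case using step[OF Suc] by (simp add: mod_Suc_eq)
  qed (use m in simp)
  \<comment> \<open>From \<open>m\<close>, going up \<open>n - m + j\<close> steps ends at
    \<open>j\<close> modulo \<open>n\<close>.\<close>
  from this[of "n - m + _"] have "j mod n \<in> S" for j using m by (simp flip: add.assoc)
  then have "{..<n} \<subseteq> S" by (metis lessThan_iff mod_less subsetI)
  with assms show False by auto
qed

text \<open>The two commuting formal variables are the inner and the outer variable of \<open>'a fps fps\<close>;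
  nested series are used because coefficients in \<open>'a\<close> do not commute.\<close>

definition gen_x :: "nat set \<Rightarrow> 'a fps fps" where
  "gen_x S = fps_const (Abs_fps (h_on S))"

definition gen_y :: "nat set \<Rightarrow> 'a fps fps" where
  "gen_y S = Abs_fps (\<lambda>k. fps_const (h_on S k))"

lemma gen_insert:
  assumes "insert m S \<subset> {..<n}" "m \<notin> S" "Suc m mod n \<notin> S"
  shows "gen_x (insert m S) = (1 + fps_const fps_X * fps_const (fps_const (u m))) * gen_x S"
    and "gen_y (insert m S) = (1 + fps_X * fps_const (fps_const (u m))) * gen_y S"
proof -
  have "Abs_fps (h_on (insert m S)) = (1 + fps_X * fps_const (u m)) * Abs_fps (h_on S)"
    by (rule fps_ext) (simp add: h_on_insert[OF assms] distrib_right mult.assoc)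
  then show "gen_x (insert m S) = (1 + fps_const fps_X * fps_const (fps_const (u m))) * gen_x S"
    by (simp add: gen_x_def distrib_right)
  show "gen_y (insert m S) = (1 + fps_X * fps_const (fps_const (u m))) * gen_y S"
    by (rule fps_ext) (simp add: gen_y_def h_on_insert[OF assms] distrib_right mult.assoc)
qed

text \<open>Induction on the size of \<open>S\<close>, removing an element \<open>m\<close> whose
  successor is absent. In the rest \<open>R\<close>, the predecessor of \<open>m\<close>, if
  present, has lost its successor \<open>m\<close>, so its factor splits off as well. What then
  remains is far from \<open>m\<close> and commutes with \<open>u m\<close>, as
  \<open>yang_baxter_swap\<close> requires.\<close>

lemma gen_commute:
  "S \<subset> {..<n} \<Longrightarrow> gen_x S * gen_y S = gen_y S * gen_x S"
proof (induction "card S" arbitrary: S rule: less_induct)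
  case less
  show ?case
  proof (cases "S = {}")
    case True
    have "Abs_fps (h_on {}) = 1" by (rule fps_ext) (simp add: h_on_empty)
    then have "gen_x S = 1" by (simp add: gen_x_def True)
    then show ?thesis by simp
  next
    case False
    define c where "c v = fps_const (fps_const v)" for v :: 'a
    define s :: "'a fps fps" where "s = fps_const fps_X"
    have s: "r * s = s * r" for r
      by (rule fps_ext) (simp add: s_def fps_mult_fps_X_commute)
    have t: "r * fps_X = fps_X * r" for r :: "'a fps fps" by (simp add: fps_mult_fps_X_commute)
    obtain m where m: "m \<in> S" "Suc m mod n \<notin> S" using exists_top[OF less.prems False] by blast
    define R where "R = S - {m}"
    have R: "S = insert m R" "m \<notin> R" "Suc m mod n \<notin> R" using m by (auto simp: R_def)
    have "finite S" using less.prems finite_subset by blast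
    then have "card R < card S" using m(1) unfolding R_def by (intro card_Diff1_less)
    with less R have IH: "gen_x R * gen_y R = gen_y R * gen_x R" by auto
    have mn: "m < n" using m less.prems by auto
    \<comment> \<open>If the predecessor of \<open>m\<close> is not in \<open>R\<close>, its generator may be replaced by \<open>0\<close>.\<close>
    obtain v T where v: "v * v = 0" "v * u m * v = u m * v * u m"
      and T: "T \<subset> {..<n}" "\<And>b. b \<in> T \<Longrightarrow> far n b m"
      and g: "gen_x R = (1 + s * c v) * gen_x T" "gen_y R = (1 + fps_X * c v) * gen_y T"
    proof (cases "\<exists>l\<in>R. Suc l mod n = m")
      case True
      then obtain l where l: "l \<in> R" "Suc l mod n = m" by blast
      have ln: "l < n" using l R less.prems by auto
      have uniq: "b = l" if "b < n" "Suc b mod n = m" for b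
        using that l ln by (auto simp: mod_Suc split: if_splits)
      show ?thesis
      proof (rule that[of "u l" "R - {l}"])
        show "u l * u l = 0" using square ln .
        show "u l * u m * u l = u m * u l * u m" using braid[OF ln] l by simp
        show "R - {l} \<subset> {..<n}" using R less.prems by auto
        have "insert l (R - {l}) = R" using l by auto
        then show "gen_x R = (1 + s * c (u l)) * gen_x (R - {l})"
          "gen_y R = (1 + fps_X * c (u l)) * gen_y (R - {l})"
          using gen_insert[of l "R - {l}"] l R less.prems by (auto simp: s_def c_def)
        show "far n b m" if "b \<in> R - {l}" for b
          using that uniq[of b] R less.prems mn by (auto simp: far_def)
      qed
    next
      case no: False
      show ?thesis
      proof (rule that[of 0 R])
        show "R \<subset> {..<n}" using R less.prems by auto
        show "far n b m" if "b \<in> R" for b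
          using that no R less.prems mn by (auto simp: far_def)
      qed (auto simp: c_def)
    qed
    have cm: "c a * c b = c (a * b)" "c 0 = 0" for a b by (simp_all add: c_def)
    have comm: "gen_x T * c (u m) = c (u m) * gen_x T" "gen_y T * c (u m) = c (u m) * gen_y T"
      by (auto simp: gen_x_def gen_y_def c_def h_on_far[OF T] intro!: fps_ext arg_cong[of _ _ fps_const])
    have gS: "gen_x S = (1 + s * c (u m)) * gen_x R" "gen_y S = (1 + fps_X * c (u m)) * gen_y R"
      using gen_insert[of m R] R less.prems by (auto simp: s_def c_def)
    show ?thesis unfolding gS g
      by (rule yang_baxter_swap[OF _ _ _ s t comm])
        (use IH g v square[OF mn] in \<open>simp_all add: cm\<close>)
  qed
qed

lemma h_on_commute:
  assumes "S \<subset> {..<n}"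
  shows "h_on S a * h_on S b = h_on S b * h_on S a"
proof -
  have "fps_nth (fps_nth (gen_x S * gen_y S) b) a = fps_nth (fps_nth (gen_y S * gen_x S) b) a"
    by (simp add: gen_commute[OF assms])
  then show ?thesis by (simp add: gen_x_def gen_y_def)
qed

end

section \<open>Pairs of sets covering the cycle\<close>

text \<open>Moebius inversion in the form of a strong induction: the values strictly below
  \<open>x\<close> already agree and can be subtracted from both sums. The order is a parameter
  because it is applied both to inclusion and to reverse inclusion.\<close>

lemma eq_if_sum_below_eq:
  fixes f g :: "'a \<Rightarrow> 'b::ab_group_add"
  assumes "finite F" and R: "reflp R" "transp R" "antisymp R"
    and sums: "\<And>x. x \<in> F \<Longrightarrow> sum f {y \<in> F. R y x} = sum g {y \<in> F. R y x}"
    and "x \<in> F"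
  shows "f x = g x"
  using \<open>x \<in> F\<close>
proof (induction "card {y \<in> F. R y x}" arbitrary: x rule: less_induct)
  case less
  let ?D = "\<lambda>x. {y \<in> F. R y x}"
  have "f y = g y" if y: "y \<in> ?D x - {x}" for y
  proof (rule less.hyps)
    have "?D y \<subseteq> ?D x" using y R(2) by (auto dest: transpD)
    moreover have "x \<notin> ?D y" using y R(3) by (auto dest: antisympD)
    moreover have "x \<in> ?D x" using less.prems R(1) by (auto dest: reflpD)
    ultimately show "card (?D y) < card (?D x)"
      using \<open>finite F\<close> by (intro psubset_card_mono) auto
  qed (use y in auto)
  then have "sum f (?D x - {x}) = sum g (?D x - {x})" by (intro sum.cong) auto
  moreover have "x \<in> ?D x" "finite (?D x)"
    using less.prems R(1) \<open>finite F\<close> by (auto dest: reflpD)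
  ultimately show ?case
    using sums[OF less.prems] by (simp add: sum.remove)
qed

context nil_coxeter_relations
begin

section \<open>Pairs of sets with a prescribed proper union\<close>

definition covers :: "nat set \<Rightarrow> nat \<Rightarrow> nat \<Rightarrow> (nat set \<times> nat set) set" where
  "covers S a b = {(A, B). A \<union> B = S \<and> card A = a \<and> card B = b}"

definition prod_pair :: "nat set \<times> nat set \<Rightarrow> 'a" where
  "prod_pair = (\<lambda>(A, B). set_prod A * set_prod B)"

lemma finite_covers: "finite S \<Longrightarrow> finite (covers S a b)"
  by (rule finite_subset[of _ "Pow S \<times> Pow S"]) (auto simp: covers_def)

lemma h_on_mult:
  assumes "finite S"
  shows "h_on S a * h_on S b = (\<Sum>T\<in>Pow S. sum prod_pair (covers T a b))"
proof -
  let ?X = "{A. A \<subseteq> S \<and> card A = a} \<times> {B. B \<subseteq> S \<and> card B = b}"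
  have "h_on S a * h_on S b = sum prod_pair ?X"
    by (simp add: h_on_def sum_product sum.cartesian_product prod_pair_def)
  also have "\<dots> = (\<Sum>T\<in>Pow S. sum prod_pair {p \<in> ?X. (case p of (A, B) \<Rightarrow> A \<union> B) = T})"
    using assms by (intro sum.group[symmetric]) auto
  also have "\<dots> = (\<Sum>T\<in>Pow S. sum prod_pair (covers T a b))"
    by (intro sum.cong refl arg_cong[of _ _ "sum prod_pair"]) (auto simp: covers_def)
  finally show ?thesis .
qed

text \<open>By \<open>h_on_mult\<close>, the commutation of \<open>h_on S a\<close> and
  \<open>h_on S b\<close> is symmetry of the sum over all pairs with union inside \<open>S\<close>.
  Inversion over the subsets isolates the pairs whose union is exactly \<open>S\<close>.\<close>

lemma covers_proper_symmetric:
  assumes "S \<subset> {..<n}"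
  shows "sum prod_pair (covers S a b) = sum prod_pair (covers S b a)"
proof (rule eq_if_sum_below_eq[where F = "{T. T \<subset> {..<n}}" and R = "(\<subseteq>)"])
  show "finite {T. T \<subset> {..<n}}" by (rule finite_subset[of _ "Pow {..<n}"]) auto
  fix S assume "S \<in> {T. T \<subset> {..<n}}"
  then have S: "S \<subset> {..<n}" "finite S" by (auto dest: finite_subset)
  then have "{T \<in> {T. T \<subset> {..<n}}. T \<subseteq> S} = Pow S" by auto
  then show "(\<Sum>T | T \<in> {T. T \<subset> {..<n}} \<and> T \<subseteq> S. sum prod_pair (covers T a b)) =
      (\<Sum>T | T \<in> {T. T \<subset> {..<n}} \<and> T \<subseteq> S. sum prod_pair (covers T b a))"
    using h_on_mult[OF S(2)] h_on_commute[OF S(1), of a b] by simp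
qed (use assms in \<open>auto simp: transp_def antisymp_def reflp_def\<close>)

text \<open>A pair \<open>(b, k)\<close> encodes the run \<open>b, b + 1, \<dots>, b + k + 1\<close> modulo \<open>n\<close>.\<close>

definition cuts :: "nat set \<Rightarrow> nat set \<Rightarrow> (nat \<times> nat) set" where
  "cuts A B = {(b, k). b < n \<and> k < n \<and> b \<in> A - B \<and> (\<forall>j<k. Suc (b + j) mod n \<in> A \<inter> B) \<and>
     Suc (b + k) mod n \<in> B - A}"

definition cut_low :: "(nat \<times> nat) set \<Rightarrow> nat set" where
  "cut_low C = fst ` C"

definition cut_inner :: "(nat \<times> nat) set \<Rightarrow> nat set" where
  "cut_inner C = (\<Union>(b, k)\<in>C. (\<lambda>j. Suc (b + j) mod n) ` {..<k})"

definition cut_high :: "(nat \<times> nat) set \<Rightarrow> nat set" where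
  "cut_high C = (\<lambda>(b, k). Suc (b + k) mod n) ` C"

section \<open>Existence and structure of runs\<close>

lemma cuts_nonempty:
  assumes AB: "A \<union> B = {..<n}" and "A \<noteq> {..<n}" "B \<noteq> {..<n}"
  shows "cuts A B \<noteq> {}"
proof -
  define K where "K k \<longleftrightarrow> (\<exists>b\<in>A - B. Suc (b + k) mod n \<in> B - A)" for k
  obtain a b where ab: "a \<in> B - A" "b \<in> A - B" "a < n" "b < n" using assms by blast
  \<comment> \<open>The number of elements strictly between \<open>b\<close> and \<open>a\<close>
    when walking upwards, passing through \<open>0\<close> if \<open>a < b\<close>. It also supplies
    the bound \<open>k < n\<close> required in \<open>cuts\<close>.\<close>
  define k0 where "k0 = (if b < a then a - b - 1 else a + n - b - 1)"
  have "a \<noteq> b" using ab by auto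
  then have "Suc (b + k0) mod n = a" "k0 < n" using ab by (auto simp: k0_def)
  with ab have k0: "K k0" "k0 < n" by (auto simp: K_def)
  \<comment> \<open>The shortest run from \<open>A - B\<close> up to \<open>B - A\<close> has all its inner elements in both sets.\<close>
  define k where "k = (LEAST k. K k)"
  have "K k" unfolding k_def using k0(1) by (rule LeastI)
  have least: "\<not> K j" if "j < k" for j using not_less_Least that unfolding k_def .
  have "k \<le> k0" unfolding k_def using k0(1) by (rule Least_le)
  obtain c where c: "c \<in> A - B" "Suc (c + k) mod n \<in> B - A" using \<open>K k\<close> by (auto simp: K_def)
  have "Suc (c + j) mod n \<in> A \<inter> B" if j: "j < k" for j
  proof (rule ccontr)
    let ?x = "Suc (c + j) mod n"
    assume "?x \<notin> A \<inter> B"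
    moreover have "?x \<in> A \<union> B" using n_ge_2 by (simp add: AB)
    moreover have "?x \<notin> B - A" using least[OF j] c by (auto simp: K_def)
    ultimately have x: "?x \<in> A - B" by auto
    \<comment> \<open>Starting from \<open>?x\<close> instead of \<open>c\<close> leaves only
      \<open>k - j - 1\<close> intermediate elements, against minimality of
      \<open>k\<close>.\<close>
    have "Suc (?x + (k - j - 1)) mod n = Suc (Suc (c + j) + (k - j - 1)) mod n"
      by (metis add_Suc mod_add_left_eq mod_Suc_eq)
    also have "\<dots> = Suc (c + k) mod n" using j by simp
    finally have "K (k - j - 1)" unfolding K_def using x c(2) by (intro bexI[of _ ?x]) simp_all
    then show False using least[of "k - j - 1"] j by simp
  qed
  then have "(c, k) \<in> cuts A B" using c \<open>k \<le> k0\<close> k0 AB by (auto simp: cuts_def)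
  then show ?thesis by blast
qed

text \<open>Containing the runs of \<open>C\<close> thus amounts to prescribing \<open>A\<close> and
  \<open>B\<close> on three index sets that depend on \<open>C\<close> alone, with no condition
  elsewhere.\<close>

lemma subset_cuts_iff:
  assumes "C \<subseteq> {..<n} \<times> {..<n}"
  shows "C \<subseteq> cuts A B \<longleftrightarrow>
    cut_low C \<subseteq> A - B \<and> cut_inner C \<subseteq> A \<inter> B \<and> cut_high C \<subseteq> B - A"
proof -
  have "C \<subseteq> cuts A B \<longleftrightarrow> (\<forall>(b, k)\<in>C. b \<in> A - B \<and> (\<forall>j<k. Suc (b + j) mod n \<in> A \<inter> B) \<and>
      Suc (b + k) mod n \<in> B - A)"
    using assms unfolding cuts_def by fast
  also have "\<dots> \<longleftrightarrow> cut_low C \<subseteq> A - B \<and> cut_inner C \<subseteq> A \<inter> B \<and> cut_high C \<subseteq> B - A"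
    unfolding cut_low_def cut_inner_def cut_high_def
    by (simp add: image_subset_iff UN_subset_iff case_prod_unfold) blast
  finally show ?thesis .
qed

text \<open>Of two runs with the same start, the shorter would end at an inner element of the
  longer, which lies in \<open>A\<close> as well as in \<open>B\<close>.\<close>

lemma card_cut_low:
  assumes "C \<subseteq> cuts A B"
  shows "card (cut_low C) = card C"
  unfolding cut_low_def
proof (intro card_image inj_onI)
  fix p q assume pq: "p \<in> C" "q \<in> C" "fst p = fst q"
  obtain b k l where bkl: "p = (b, k)" "q = (b, l)" using pq by (cases p, cases q) auto
  have "k = l"
  proof (rule ccontr)
    assume "k \<noteq> l"
    then consider "k < l" | "l < k" by linarith
    moreover have "(b, k) \<in> cuts A B" "(b, l) \<in> cuts A B" using pq assms by (auto simp: bkl)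
    ultimately show False by cases (auto simp: cuts_def)
  qed
  then show "p = q" by (simp add: bkl)
qed

text \<open>Of two runs with the same end, the shorter would start at an inner element of the
  longer.\<close>

lemma card_cut_high:
  assumes "C \<subseteq> cuts A B"
  shows "card (cut_high C) = card C"
  unfolding cut_high_def
proof (intro card_image inj_onI)
  have eq: "b = c \<and> k = l" if "(b, k) \<in> C" "(c, l) \<in> C" "k \<le> l"
    "Suc (b + k) mod n = Suc (c + l) mod n" for b c k l
  proof -
    have cut: "(b, k) \<in> cuts A B" "(c, l) \<in> cuts A B" using assms that by auto
    \<comment> \<open>Cancelling \<open>Suc k\<close> locates the start of the shorter run
      \<open>l - k\<close> steps above \<open>c\<close>.\<close>
    have "[b + Suc k = c + (l - k) + Suc k] (mod n)" using that by (simp add: cong_def)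
    then have b: "b = (c + (l - k)) mod n"
      using cut by (auto simp only: cong_add_rcancel_nat) (auto simp: cong_def cuts_def)
    have "k = l"
    proof (rule ccontr)
      assume "k \<noteq> l"
      with \<open>k \<le> l\<close> have "c + (l - k) = Suc (c + (l - k - 1))" "l - k - 1 < l" by auto
      with b have "b = Suc (c + (l - k - 1)) mod n" "l - k - 1 < l" by simp_all
      with cut show False by (auto simp: cuts_def)
    qed
    with b cut show ?thesis by (auto simp: cuts_def)
  qed
  fix p q assume "p \<in> C" "q \<in> C"
    "(case p of (b, k) \<Rightarrow> Suc (b + k) mod n) = (case q of (b, k) \<Rightarrow> Suc (b + k) mod n)"
  then show "p = q"
    using eq[of "fst p" "snd p" "fst q" "snd q"] eq[of "fst q" "snd q" "fst p" "snd p"]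
    by (cases "snd p \<le> snd q") (auto simp: case_prod_unfold prod_eq_iff)
qed

text \<open>Together with \<open>cut_pred\<close> this provides the adjacency conditions of
  \<open>set_prod_union\<close>: no index outside the runs follows a low or inner element, and no
  inner or high element follows an index outside the runs.\<close>

lemma cut_succ:
  assumes "i \<in> cut_low C \<union> cut_inner C"
  shows "Suc i mod n \<in> cut_inner C \<union> cut_high C"
proof -
  \<comment> \<open>Here \<open>j\<close> is the position of \<open>i\<close> in the run, with
    \<open>j = 0\<close> for its start.\<close>
  obtain b k j where C: "(b, k) \<in> C" and j: "j \<le> k" "Suc i mod n = Suc (b + j) mod n"
    using assms
  proof
    assume "i \<in> cut_low C"
    then show ?thesis using that[of i _ 0] by (auto simp: cut_low_def)
  next
    assume "i \<in> cut_inner C"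
    then obtain b k j where "(b, k) \<in> C" "j < k" "i = Suc (b + j) mod n"
      by (auto simp: cut_inner_def)
    then show ?thesis using that[of b k "Suc j"] by (simp add: mod_Suc_eq)
  qed
  show ?thesis
  proof (cases "j = k")
    case True
    then have "Suc i mod n \<in> cut_high C" using C j by (force simp: cut_high_def)
    then show ?thesis by simp
  next
    case False
    then have "Suc i mod n \<in> cut_inner C" using C j by (auto simp: cut_inner_def intro!: bexI[of _ "(b, k)"])
    then show ?thesis by simp
  qed
qed

lemma cut_pred:
  assumes "Suc i mod n \<in> cut_inner C \<union> cut_high C" "i < n" "C \<subseteq> {..<n} \<times> {..<n}"
  shows "i \<in> cut_low C \<union> cut_inner C"
proof -
  obtain b k j where C: "(b, k) \<in> C" and j: "j \<le> k" "Suc i mod n = Suc (b + j) mod n"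
    using assms(1)
  proof
    assume "Suc i mod n \<in> cut_inner C"
    then obtain b k j where "(b, k) \<in> C" "j < k" "Suc i mod n = Suc (b + j) mod n"
      by (auto simp: cut_inner_def)
    then show ?thesis using that[of b k j] by simp
  qed (use that in \<open>auto simp: cut_high_def\<close>)
  have "[i + 1 = b + j + 1] (mod n)" using j by (simp add: cong_def)
  then have i: "i = (b + j) mod n"
    using \<open>i < n\<close> by (simp only: cong_add_rcancel_nat) (simp add: cong_def)
  show ?thesis
  proof (cases j)
    case 0
    then have "i = b" using i C assms(3) by auto
    then show ?thesis using C by (force simp: cut_low_def)
  next
    case (Suc l)
    then have "i \<in> cut_inner C" using C i j by (auto simp: cut_inner_def intro!: bexI[of _ "(b, k)"])
    then show ?thesis by simp
  qed
qed

text \<open>The outer factors \<open>set_prod P\<close> and \<open>set_prod Q\<close> depend only on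
  \<open>C\<close>, so symmetry is inherited from the middle sum over pairs with union
  \<open>I\<close>. Since \<open>C\<close> is nonempty, \<open>I\<close> is a proper subset and
  \<open>covers_proper_symmetric\<close> applies.\<close>

lemma cut_covers_symmetric:
  assumes C: "C \<subseteq> {..<n} \<times> {..<n}" "C \<noteq> {}"
  shows "sum prod_pair {(A, B) \<in> covers {..<n} a b. C \<subseteq> cuts A B} =
         sum prod_pair {(A, B) \<in> covers {..<n} b a. C \<subseteq> cuts A B}"
\<comment> \<open>If no covering pair contains the runs of \<open>C\<close>, both sums are empty.
  Otherwise a single such pair already shows that the low, inner and high elements are disjoint and
  equally many are low as high.\<close>
proof (cases "\<exists>A B. A \<union> B = {..<n} \<and> C \<subseteq> cuts A B")
  case False
  then have empty: "{(A, B) \<in> covers {..<n} a b. C \<subseteq> cuts A B} = {}" for a b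
    unfolding covers_def by blast
  show ?thesis unfolding empty ..
next
  case True
  then obtain A0 B0 where AB0: "A0 \<union> B0 = {..<n}" "C \<subseteq> cuts A0 B0" by blast
  let ?L = "cut_low C" and ?J = "cut_inner C" and ?H = "cut_high C"
  note iff = subset_cuts_iff[OF C(1)]
  define P where "P = ?L \<union> ?J"
  define Q where "Q = ?J \<union> ?H"
  define I where "I = {..<n} - (?L \<union> ?J \<union> ?H)"
  have sub: "?L \<subseteq> {..<n}" "?J \<subseteq> {..<n}" "?H \<subseteq> {..<n}"
    and disj: "?L \<inter> ?J = {}" "?H \<inter> ?J = {}" "?L \<inter> ?H = {}"
    using AB0 unfolding iff by auto
  have ne: "?L \<noteq> {}" "?H \<noteq> {}" using C(2) by (auto simp: cut_low_def cut_high_def)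
  have fin: "finite ?L" "finite ?J" "finite ?H" "finite P" "finite Q" "finite I"
    using sub finite_subset[of _ "{..<n}"] by (auto simp: P_def Q_def I_def)
  have cards: "card Q = card P"
    using card_cut_low[OF AB0(2)] card_cut_high[OF AB0(2)] fin disj
    by (simp add: P_def Q_def card_Un_disjoint Int_commute)
  \<comment> \<open>The cardinality of \<open>P\<close> is added rather than subtracted from
    \<open>a\<close> and \<open>b\<close>, so that the set is empty when one of them is too
    small.\<close>
  define Z where "Z a b = {(A, B). A \<union> B = I \<and> card A + card P = a \<and> card B + card P = b}" for a b
  have Z: "sum prod_pair (Z a b) = sum prod_pair (Z b a)" for a b
  proof (cases "card P \<le> a \<and> card P \<le> b")
    case True
    then have "Z a b = covers I (a - card P) (b - card P)" "Z b a = covers I (b - card P) (a - card P)"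
      by (auto simp: Z_def covers_def)
    moreover have "I \<subset> {..<n}" using ne sub by (auto simp: I_def)
    ultimately show ?thesis using covers_proper_symmetric by simp
  next
    case False
    then have "Z a b = {}" "Z b a = {}" by (auto simp: Z_def)
    then show ?thesis by simp
  qed
  have prods: "set_prod (P \<union> A) = set_prod P * set_prod A" "set_prod (B \<union> Q) = set_prod B * set_prod Q"
    if "A \<subseteq> I" "B \<subseteq> I" for A B
  proof (rule_tac [!] set_prod_union)
    show "P \<union> A \<subset> {..<n}" "B \<union> Q \<subset> {..<n}"
      using that ne sub disj by (auto simp: P_def Q_def I_def)
    show "P \<inter> A = {}" "B \<inter> Q = {}" using that by (auto simp: P_def Q_def I_def)
    show "Suc i mod n \<notin> A" if "i \<in> P" for i
      using cut_succ[of i C] that \<open>A \<subseteq> I\<close> by (auto simp: P_def I_def)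
    show "Suc i mod n \<notin> Q" if "i \<in> B" for i
      using cut_pred[OF _ _ C(1), of i] that \<open>B \<subseteq> I\<close> by (auto simp: Q_def I_def)
  qed
  have sum: "sum prod_pair {(A, B) \<in> covers {..<n} a b. C \<subseteq> cuts A B} =
      set_prod P * sum prod_pair (Z a b) * set_prod Q" for a b
  proof -
    have "(\<Sum>p\<in>Z a b. set_prod P * prod_pair p * set_prod Q) =
        sum prod_pair {(A, B) \<in> covers {..<n} a b. C \<subseteq> cuts A B}"
    \<comment> \<open>Adjoining \<open>P\<close> and \<open>Q\<close> is inverted by intersecting
      with \<open>I\<close>.\<close>
    proof (rule sum.reindex_bij_witness[where
          i = "\<lambda>(A, B). (A \<inter> I, B \<inter> I)" and j = "\<lambda>(A, B). (P \<union> A, B \<union> Q)"])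
      fix p assume "p \<in> Z a b"
      then obtain A B where p: "p = (A, B)" and AB: "A \<union> B = I" "card A + card P = a" "card B + card P = b"
        by (auto simp: Z_def)
      then have sI: "A \<subseteq> I" "B \<subseteq> I" by auto
      have d: "P \<inter> A = {}" "B \<inter> Q = {}" "P \<inter> I = {}" "Q \<inter> I = {}"
        using sI by (auto simp: P_def Q_def I_def)
      show "(case (case p of (A, B) \<Rightarrow> (P \<union> A, B \<union> Q)) of (A, B) \<Rightarrow> (A \<inter> I, B \<inter> I)) = p"
        using sI d by (auto simp: p)
      have "finite A" "finite B" using sI fin finite_subset by blast+
      then have "card (P \<union> A) = a" "card (B \<union> Q) = b"
        using d fin AB cards by (simp_all add: card_Un_disjoint)
      moreover have "(P \<union> A) \<union> (B \<union> Q) = {..<n}"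
        using AB(1) sub by (auto simp: P_def Q_def I_def)
      moreover have "C \<subseteq> cuts (P \<union> A) (B \<union> Q)"
        unfolding iff using disj sI by (auto simp: P_def Q_def I_def)
      ultimately show "(case p of (A, B) \<Rightarrow> (P \<union> A, B \<union> Q)) \<in> {(A, B) \<in> covers {..<n} a b. C \<subseteq> cuts A B}"
        by (simp add: p covers_def)
      show "prod_pair (case p of (A, B) \<Rightarrow> (P \<union> A, B \<union> Q)) = set_prod P * prod_pair p * set_prod Q"
        using sI by (simp add: p prod_pair_def prods mult.assoc)
    next
      fix p assume "p \<in> {(A, B) \<in> covers {..<n} a b. C \<subseteq> cuts A B}"
      then obtain A B where p: "p = (A, B)" and AB: "A \<union> B = {..<n}" "card A = a" "card B = b"
        and "C \<subseteq> cuts A B" by (auto simp: covers_def)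
      then have LJH: "?L \<subseteq> A - B" "?J \<subseteq> A \<inter> B" "?H \<subseteq> B - A" unfolding iff by auto
      have A: "A = P \<union> A \<inter> I" and B: "B = B \<inter> I \<union> Q"
        using LJH AB(1) by (auto simp: P_def Q_def I_def)
      show "(case (case p of (A, B) \<Rightarrow> (A \<inter> I, B \<inter> I)) of (A, B) \<Rightarrow> (P \<union> A, B \<union> Q)) = p"
        using A B by (simp add: p)
      have "P \<inter> (A \<inter> I) = {}" "(B \<inter> I) \<inter> Q = {}" by (auto simp: P_def Q_def I_def)
      then have "card A = card (A \<inter> I) + card P" "card B = card (B \<inter> I) + card P"
        using fin cards by (subst A B, subst card_Un_disjoint; simp)+
      moreover have "A \<inter> I \<union> B \<inter> I = I" using AB(1) by (auto simp: I_def)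
      ultimately show "(case p of (A, B) \<Rightarrow> (A \<inter> I, B \<inter> I)) \<in> Z a b"
        using AB by (simp add: p Z_def)
    qed
    then show ?thesis unfolding sum_distrib_left sum_distrib_right ..
  qed
  show ?thesis unfolding sum by (simp only: Z[of a b])
qed

text \<open>With \<open>a\<close> and \<open>b\<close> below \<open>n\<close>, neither set is the
  whole cycle, so every pair has a nonempty set of cuts. The pairs are sorted by this set, and
  inversion over supersets passes from pairs whose cuts contain \<open>X\<close> to pairs whose cuts
  are exactly \<open>C\<close>. The empty set is excluded from \<open>?F\<close> because
  \<open>cut_covers_symmetric\<close> requires a nonempty set.\<close>

lemma covers_all_symmetric:
  assumes "a < n" "b < n"
  shows "sum prod_pair (covers {..<n} a b) = sum prod_pair (covers {..<n} b a)"
proof -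
  let ?F = "Pow ({..<n} \<times> {..<n}) - {{}}"
  let ?N = "\<lambda>a b C. sum prod_pair {(A, B) \<in> covers {..<n} a b. cuts A B = C}"
  have cuts: "cuts A B \<subseteq> {..<n} \<times> {..<n}" for A B by (auto simp: cuts_def)
  have fin: "finite (covers {..<n} a b)" for a b by (rule finite_covers) simp
  have group: "sum (?N a b) {C \<in> ?F. X \<subseteq> C} = sum prod_pair {(A, B) \<in> covers {..<n} a b. X \<subseteq> cuts A B}"
    if "X \<noteq> {}" for X a b
  proof -
    let ?S = "{(A, B) \<in> covers {..<n} a b. X \<subseteq> cuts A B}"
    have "sum prod_pair ?S = (\<Sum>C\<in>{C \<in> ?F. X \<subseteq> C}. sum prod_pair {p \<in> ?S. (case p of (A, B) \<Rightarrow> cuts A B) = C})"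
    proof (rule sum.group[symmetric])
      show "finite ?S" by (rule finite_subset[OF _ fin[of a b]]) auto
      show "(\<lambda>(A, B). cuts A B) ` ?S \<subseteq> {C \<in> ?F. X \<subseteq> C}" using that cuts by fastforce
    qed simp
    also have "\<dots> = sum (?N a b) {C \<in> ?F. X \<subseteq> C}"
      by (intro sum.cong refl arg_cong[of _ _ "sum prod_pair"]) auto
    finally show ?thesis by simp
  qed
  have N: "?N a b C = ?N b a C" if "C \<in> ?F" for C
  proof (rule eq_if_sum_below_eq[where f = "?N a b" and g = "?N b a" and F = ?F and R = "(\<supseteq>)"])
    fix X assume "X \<in> ?F"
    then have X: "X \<subseteq> {..<n} \<times> {..<n}" "X \<noteq> {}" by auto
    show "sum (?N a b) {C \<in> ?F. X \<subseteq> C} = sum (?N b a) {C \<in> ?F. X \<subseteq> C}"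
      unfolding group[OF X(2)] by (rule cut_covers_symmetric[OF X])
  next
    show "C \<in> ?F" by (rule that)
    show "finite ?F" by simp
    show "reflp (\<lambda>X Y :: (nat \<times> nat) set. Y \<subseteq> X)" by (rule reflpI) simp
    show "transp (\<lambda>X Y :: (nat \<times> nat) set. Y \<subseteq> X)" by (rule transpI) (rule order_trans)
    show "antisymp (\<lambda>X Y :: (nat \<times> nat) set. Y \<subseteq> X)" by (rule antisympI) (rule equalityI)
  qed
  have total: "sum prod_pair (covers {..<n} a b) = sum (?N a b) ?F" if "a < n" "b < n" for a b
  proof -
    have "sum prod_pair (covers {..<n} a b) =
        (\<Sum>C\<in>?F. sum prod_pair {p \<in> covers {..<n} a b. (case p of (A, B) \<Rightarrow> cuts A B) = C})"
    proof (rule sum.group[symmetric])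
      have "cuts A B \<in> ?F" if "(A, B) \<in> covers {..<n} a b" for A B
      proof -
        have AB: "A \<union> B = {..<n}" "card A < n" "card B < n"
          using that \<open>a < n\<close> \<open>b < n\<close> by (simp_all add: covers_def)
        have "cuts A B \<noteq> {}"
          by (rule cuts_nonempty[OF AB(1)]) (use AB(2,3) in force)+
        then show ?thesis using cuts[of A B] by simp
      qed
      then show "(\<lambda>(A, B). cuts A B) ` covers {..<n} a b \<subseteq> ?F" by force
    qed (use fin in auto)
    also have "\<dots> = sum (?N a b) ?F"
      by (intro sum.cong refl arg_cong[of _ _ "sum prod_pair"]) auto
    finally show ?thesis .
  qed
  show ?thesis using N by (simp add: total assms)
qed

lemma h_commute:
  assumes "a < n" "b < n"
  shows "h_on {..<n} a * h_on {..<n} b = h_on {..<n} b * h_on {..<n} a"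
proof -
  have "sum prod_pair (covers T a b) = sum prod_pair (covers T b a)" if "T \<subseteq> {..<n}" for T
    using covers_proper_symmetric[of T a b] covers_all_symmetric[OF assms] that by blast
  then show ?thesis by (simp add: h_on_mult)
qed

end

section \<open>Linear operators on the group algebra\<close>

lemma scale_vec_minus: "scale_vec c (- v) = - scale_vec c v"
  by (rule poly_mapping_eqI) (simp add: lookup_uminus)

text \<open>Linear operators become a type in order to form an instance of \<open>ring_1\<close>, as
  the locale demands. They act on all of \<open>vec\<close>, since the type cannot depend on
  \<open>n\<close>.\<close>

typedef vec_op = "{f. linear_op f}" morphisms apply_op Op
  by (rule exI[of _ "\<lambda>v. v"]) (simp add: linear_op_def)

lemma linear_op_apply_op: "linear_op (apply_op f)"
  using apply_op[of f] by simp

lemma apply_op_add: "apply_op f (u + v) = apply_op f u + apply_op f v"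
  using linear_op_apply_op[of f] by (simp add: linear_op_def)

lemma apply_op_scale: "apply_op f (scale_vec c v) = scale_vec c (apply_op f v)"
  using linear_op_apply_op[of f] by (simp add: linear_op_def)

lemma apply_Op: "linear_op f \<Longrightarrow> apply_op (Op f) v = f v"
  by (simp add: Op_inverse)

lemma apply_op_eqI: "(\<And>v. apply_op f v = apply_op g v) \<Longrightarrow> f = g"
  by (simp add: ext flip: apply_op_inject)

instantiation vec_op :: ring_1
begin

definition zero_vec_op :: vec_op where "0 = Op (\<lambda>v. 0)"
definition one_vec_op :: vec_op where "1 = Op (\<lambda>v. v)"
definition plus_vec_op :: "vec_op \<Rightarrow> vec_op \<Rightarrow> vec_op" where
  "f + g = Op (\<lambda>v. apply_op f v + apply_op g v)"
definition uminus_vec_op :: "vec_op \<Rightarrow> vec_op" where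
  "- f = Op (\<lambda>v. - apply_op f v)"
definition minus_vec_op :: "vec_op \<Rightarrow> vec_op \<Rightarrow> vec_op" where
  "f - g = f + - (g :: vec_op)"
definition times_vec_op :: "vec_op \<Rightarrow> vec_op \<Rightarrow> vec_op" where
  "f * g = Op (\<lambda>v. apply_op f (apply_op g v))"

lemma apply_op_simps [simp]:
  "apply_op 0 v = 0" "apply_op 1 v = v" "apply_op (f + g) v = apply_op f v + apply_op g v"
  "apply_op (- f) v = - apply_op f v" "apply_op (f - g) v = apply_op f v - apply_op g v"
  "apply_op (f * g) v = apply_op f (apply_op g v)"
proof -
  show "apply_op 0 v = 0" "apply_op 1 v = v"
    unfolding zero_vec_op_def one_vec_op_def by (simp_all add: apply_Op linear_op_def)
  show add: "apply_op (f + g) v = apply_op f v + apply_op g v" for f g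
    unfolding plus_vec_op_def by (subst apply_Op) (simp_all add: linear_op_def apply_op_add apply_op_scale add_ac)
  show minus: "apply_op (- f) v = - apply_op f v" for f
    unfolding uminus_vec_op_def
    by (subst apply_Op) (simp_all add: linear_op_def apply_op_add apply_op_scale scale_vec_minus)
  show "apply_op (f - g) v = apply_op f v - apply_op g v"
    unfolding minus_vec_op_def add minus by simp
  show "apply_op (f * g) v = apply_op f (apply_op g v)"
    unfolding times_vec_op_def by (subst apply_Op) (simp_all add: linear_op_def apply_op_add apply_op_scale)
qed

instance
proof
  show "(0 :: vec_op) \<noteq> 1"
  proof
    assume "(0 :: vec_op) = 1"
    then have "apply_op 0 (basis_vec {}) = apply_op 1 (basis_vec {})" by (simp only:)
    then show False by (metis apply_op_simps(1,2) lookup_basis_vec lookup_zero zero_neq_one)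
  qed
qed (rule apply_op_eqI, simp add: apply_op_add add_ac)+

end

lemma apply_op_sum: "apply_op (sum f A) v = (\<Sum>a\<in>A. apply_op (f a) v)"
  by (induction A rule: infinite_finite_induct) auto

text \<open>The maps \<^const>\<open>gen_act\<close> satisfy the relations only on \<^const>\<open>group_space\<close>, so they are
  precomposed with the projection to it.\<close>

definition restrict_vec :: "nat \<Rightarrow> vec \<Rightarrow> vec" where
  "restrict_vec n = Poly_Mapping.mapp (\<lambda>w c. if w \<in> carrier (affine_sym n) then c else 0)"

lemma lookup_restrict_vec:
  "Poly_Mapping.lookup (restrict_vec n v) w =
    (if w \<in> carrier (affine_sym n) then Poly_Mapping.lookup v w else 0)"
  by (simp add: restrict_vec_def lookup_mapp when_def in_keys_iff)

lemma restrict_vec_closed: "restrict_vec n v \<in> group_space n"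
  by (auto simp: group_space_def in_keys_iff lookup_restrict_vec split: if_splits)

lemma restrict_vec_id: "v \<in> group_space n \<Longrightarrow> restrict_vec n v = v"
  by (rule poly_mapping_eqI) (auto simp: lookup_restrict_vec group_space_def in_keys_iff subset_iff)

lemma linear_op_restrict_vec: "linear_op (restrict_vec n)"
  unfolding linear_op_def
  by (intro conjI allI; rule poly_mapping_eqI) (simp_all add: lookup_restrict_vec lookup_add)

definition gen_op :: "nat \<Rightarrow> nat \<Rightarrow> vec_op" where
  "gen_op n i = Op (\<lambda>v. gen_act n i (restrict_vec n v))"

lemma apply_gen_op: "apply_op (gen_op n i) v = gen_act n i (restrict_vec n v)"
  unfolding gen_op_def
  by (rule apply_Op, rule linear_op_comp[OF linear_op_gen_act linear_op_restrict_vec])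

lemma nil_coxeter_relations_gen_op:
  assumes "n \<ge> 3"
  shows "nil_coxeter_relations n (gen_op n)"
proof
  fix i j assume i: "i < n"
  show "gen_op n i * gen_op n i = 0"
    using i by (intro apply_op_eqI)
      (simp add: apply_gen_op restrict_vec_id restrict_vec_closed gen_act_closed gen_act_square)
  assume j: "j = Suc i mod n"
  then have "j < n" using i by simp
  with i show "gen_op n i * gen_op n j * gen_op n i = gen_op n j * gen_op n i * gen_op n j"
    by (intro apply_op_eqI)
      (simp add: apply_gen_op restrict_vec_id restrict_vec_closed gen_act_closed
        gen_act_braid[OF i j restrict_vec_closed])
next
  fix i j assume ij: "far n i j"
  then have "i < n" "j < n" by (auto simp: far_def)
  then show "gen_op n i * gen_op n j = gen_op n j * gen_op n i"
    by (intro apply_op_eqI)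
      (simp add: apply_gen_op restrict_vec_id restrict_vec_closed gen_act_closed
        gen_act_comm[OF ij restrict_vec_closed])
qed (use assms in simp)

section \<open>The action of the algebra expressed by operators\<close>

lemma nil_act_add:
  assumes "X \<in> carrier (nil_coxeter n)" "Y \<in> carrier (nil_coxeter n)" "v \<in> group_space n"
  shows "nil_act n (X \<oplus>\<^bsub>nil_coxeter n\<^esub> Y) v = nil_act n X v + nil_act n Y v"
proof -
  interpret R: ring "free_algebra n" by (rule ring_free_algebra)
  obtain p q where pq: "p \<in> carrier (free_algebra n)" "q \<in> carrier (free_algebra n)"
    "X = nil_ideal n +>\<^bsub>free_algebra n\<^esub> p" "Y = nil_ideal n +>\<^bsub>free_algebra n\<^esub> q"
    using assms by (auto simp: nil_coxeter_carrier)
  then have "X \<oplus>\<^bsub>nil_coxeter n\<^esub> Y = nil_ideal n +>\<^bsub>free_algebra n\<^esub> (p \<oplus>\<^bsub>free_algebra n\<^esub> q)"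
    using ring_hom_add[OF nil_proj_hom] by simp
  moreover have "p \<oplus>\<^bsub>free_algebra n\<^esub> q = p + q" by (simp add: free_algebra_def)
  ultimately show ?thesis
    using pq assms(3) R.a_closed[OF pq(1,2)] by (simp add: nil_act_coset free_act_add)
qed

lemma nil_act_zero:
  assumes "v \<in> group_space n"
  shows "nil_act n \<zero>\<^bsub>nil_coxeter n\<^esub> v = 0"
proof -
  interpret U: ring "nil_coxeter n" by (rule ring_nil_coxeter)
  show ?thesis using nil_act_add[OF U.zero_closed U.zero_closed assms] by simp
qed

lemma nil_act_finsum:
  assumes "finite S" "\<And>A. A \<in> S \<Longrightarrow> f A \<in> carrier (nil_coxeter n)" "v \<in> group_space n"
  shows "nil_act n (\<Oplus>\<^bsub>nil_coxeter n\<^esub>A \<in> S. f A) v = (\<Sum>A\<in>S. nil_act n (f A) v)"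
proof -
  interpret U: ring "nil_coxeter n" by (rule ring_nil_coxeter)
  show ?thesis
    using assms(1,2)
  proof (induction S rule: finite_induct)
    case (insert A S)
    then show ?case using assms(3) by (simp add: U.finsum_insert nil_act_add Pi_I)
  qed (simp add: nil_act_zero assms(3))
qed

lemma nil_act_word:
  "x \<in> words n \<Longrightarrow> v \<in> group_space n \<Longrightarrow> nil_act n (nil_word n x) v = foldr (gen_act n) x v"
proof (induction x)
  case (Cons i x)
  then have "i < n" "x \<in> words n" by auto
  with Cons show ?case
    by (simp add: nil_word_Cons nil_act_mult nil_gen_closed nil_word_closed nil_act_gen word_act_closed
        del: in_lists_conv_set)
qed (simp add: nil_word_Nil nil_act_one)

text \<open>The choices behind \<open>nil_set\<close> and \<open>set_prod\<close> are both replaced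
  by one word \<open>xs\<close>. The word is exported because its length enters the degree
  count.\<close>

lemma nil_act_nil_set:
  assumes "n \<ge> 3" "A \<subset> {..<n}" "v \<in> group_space n"
  obtains xs where "decreasing_word n A xs" "xs \<in> words n"
    and "nil_act n (nil_set n A) v = foldr (gen_act n) xs v"
    and "apply_op (nil_coxeter_relations.set_prod n (gen_op n) A) v = foldr (gen_act n) xs v"
proof -
  interpret nil_coxeter_relations n "gen_op n"
    by (rule nil_coxeter_relations_gen_op[OF assms(1)])
  obtain xs where xs: "decreasing_word n A xs"
    using decreasing_word_exists[OF n_ge_2 assms(2)] by blast
  then have words: "xs \<in> words n" using assms(2) by (auto simp: decreasing_word_def)
  have "apply_op (word_prod ys) v = foldr (gen_act n) ys v" if "ys \<in> words n" for ys
    using that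
  proof (induction ys)
    case (Cons i ys)
    then show ?case
      using restrict_vec_id[OF word_act_closed[of ys n v]] assms(3)
      by (simp add: apply_gen_op)
  qed simp
  then show ?thesis
    using that xs words assms set_prod_eq[of A xs] nil_set_eq[OF n_ge_2, of A xs]
    by (simp add: nil_act_word psubset_imp_subset del: in_lists_conv_set)
qed

text \<open>The bound on \<open>k\<close> makes every index set proper, so that decreasing words
  exist. The first form serves the degree count, the second transfers commutation from the operator
  ring.\<close>

lemma nil_act_nil_h:
  assumes "n \<ge> 3" "k < n" "v \<in> group_space n"
  shows "nil_act n (nil_h n k) v = (\<Sum>A | A \<subseteq> {..<n} \<and> card A = k. nil_act n (nil_set n A) v)"
    and "nil_act n (nil_h n k) v = apply_op (nil_coxeter_relations.h_on n (gen_op n) {..<n} k) v"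
proof -
  interpret nil_coxeter_relations n "gen_op n"
    by (rule nil_coxeter_relations_gen_op[OF assms(1)])
  have proper: "A \<subset> {..<n}" if "A \<subseteq> {..<n}" "card A = k" for A using that assms(2) by auto
  show "nil_act n (nil_h n k) v = (\<Sum>A | A \<subseteq> {..<n} \<and> card A = k. nil_act n (nil_set n A) v)"
    unfolding nil_h_def
    by (rule nil_act_finsum) (use proper nil_set_closed[OF n_ge_2] assms(3) in auto)
  also have "\<dots> = apply_op (h_on {..<n} k) v"
    unfolding h_on_def apply_op_sum
  proof (intro sum.cong refl)
    fix A assume "A \<in> {A. A \<subseteq> {..<n} \<and> card A = k}"
    with proper have "A \<subset> {..<n}" by blast
    from nil_act_nil_set[OF assms(1) this assms(3)]
    show "nil_act n (nil_set n A) v = apply_op (set_prod A) v" by metis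
  qed
  finally show "nil_act n (nil_h n k) v = apply_op (h_on {..<n} k) v" .
qed

text \<open>The operators \<open>h_on {..<n} a\<close> commute on all of \<open>vec\<close>, which
  permits reordering the fold; on \<open>group_space\<close> they agree with the action of
  \<open>nil_h\<close>.\<close>

lemma nil_act_fold_mset:
  assumes "n \<ge> 3" "\<forall>a \<in> set as. a < n" "v \<in> group_space n" "mset as = mset bs"
  shows "fold (\<lambda>a. nil_act n (nil_h n a)) as v = fold (\<lambda>a. nil_act n (nil_h n a)) bs v"
proof -
  interpret nil_coxeter_relations n "gen_op n"
    by (rule nil_coxeter_relations_gen_op[OF assms(1)])
  let ?f = "\<lambda>a. apply_op (h_on {..<n} a)"
  have eq: "fold (\<lambda>a. nil_act n (nil_h n a)) cs u = fold ?f cs u"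
    if "\<forall>a \<in> set cs. a < n" "u \<in> group_space n" for cs u
    using that
  proof (induction cs arbitrary: u)
    case (Cons a cs)
    then show ?case
      using nil_act_nil_h(2)[OF assms(1), of a u] nil_act_closed[OF nil_h_closed[OF n_ge_2], of a u]
      by simp
  qed simp
  have "fold ?f as = fold ?f bs"
  proof (rule fold_multiset_equiv)
    fix a b assume "a \<in> set as" "b \<in> set as"
    then have "h_on {..<n} a * h_on {..<n} b = h_on {..<n} b * h_on {..<n} a"
      using assms(2) by (intro h_commute) auto
    then show "?f a \<circ> ?f b = ?f b \<circ> ?f a" by (metis apply_op_simps(6) comp_apply ext)
  qed (rule assms(4))
  then show ?thesis using eq[of as v] eq[of bs v] assms mset_eq_setD[OF assms(4)] by simp
qed

section \<open>Grading by length and homogeneity\<close>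

definition graded_space :: "nat \<Rightarrow> nat \<Rightarrow> vec set" where
  "graded_space n l = {v \<in> group_space n. \<forall>w \<in> Poly_Mapping.keys v. cox_length n w = l}"

lemma graded_space_zero: "0 \<in> graded_space n l"
  by (simp add: graded_space_def group_space_def)

lemma graded_space_add: "u \<in> graded_space n l \<Longrightarrow> v \<in> graded_space n l \<Longrightarrow> u + v \<in> graded_space n l"
  using Poly_Mapping.keys_add[of u v] unfolding graded_space_def group_space_def by blast

lemma graded_space_sum:
  assumes "\<And>a. a \<in> A \<Longrightarrow> f a \<in> graded_space n l"
  shows "sum f A \<in> graded_space n l"
  using assms
  by (induction A rule: infinite_finite_induct) (simp_all add: graded_space_zero graded_space_add)

text \<open>A surviving term increases the length, and by \<open>cox_length_gen\<close> it does so
  by exactly one.\<close>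

lemma gen_act_graded:
  assumes "i < n" "v \<in> graded_space n l"
  shows "gen_act n i v \<in> graded_space n (Suc l)"
  unfolding gen_act_def
proof (rule graded_space_sum)
  let ?m = "\<lambda>w. cox_gen n i \<otimes>\<^bsub>affine_sym n\<^esub> w"
  fix w assume "w \<in> Poly_Mapping.keys v"
  then have w: "w \<in> carrier (affine_sym n)" "cox_length n w = l"
    using assms(2) by (auto simp: graded_space_def group_space_def)
  have "scale_vec c (basis_vec (?m w)) \<in> graded_space n (Suc l)"
    if "cox_length n (?m w) > cox_length n w" for c
  proof -
    have "cox_length n (?m w) = Suc l" using that cox_length_gen[OF assms(1) w(1)] w(2) by simp
    moreover have "scale_vec c (basis_vec (?m w)) \<in> group_space n"
      by (intro group_space_scale basis_vec_closed cox_gen_mult_closed assms w)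
    ultimately show ?thesis
      by (auto simp: graded_space_def in_keys_iff lookup_basis_vec split: if_splits)
  qed
  then show "(if cox_length n (?m w) > cox_length n w
     then scale_vec (Poly_Mapping.lookup v w) (basis_vec (?m w)) else 0) \<in> graded_space n (Suc l)"
    by (simp add: graded_space_zero)
qed

lemma word_act_graded:
  "x \<in> words n \<Longrightarrow> v \<in> graded_space n l \<Longrightarrow> foldr (gen_act n) x v \<in> graded_space n (l + length x)"
  by (induction x) (auto intro: gen_act_graded)

lemma nil_h_graded:
  assumes "n \<ge> 3" "k < n" "v \<in> graded_space n l"
  shows "nil_act n (nil_h n k) v \<in> graded_space n (l + k)"
proof -
  have v: "v \<in> group_space n" using assms(3) by (simp add: graded_space_def)
  show ?thesis
    unfolding nil_act_nil_h(1)[OF assms(1,2) v]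
  proof (rule graded_space_sum)
    fix A assume A: "A \<in> {A. A \<subseteq> {..<n} \<and> card A = k}"
    then have "A \<subset> {..<n}" using assms(2) by auto
    then obtain xs where xs: "decreasing_word n A xs" "xs \<in> words n"
      and act: "nil_act n (nil_set n A) v = foldr (gen_act n) xs v"
      using nil_act_nil_set[OF assms(1) _ v] by metis
    have "length xs = k" using xs(1) A distinct_card[of xs] by (auto simp: decreasing_word_def)
    then show "nil_act n (nil_set n A) v \<in> graded_space n (l + k)"
      unfolding act using word_act_graded[OF xs(2) assms(3)] by simp
  qed
qed

lemma cox_length_one: "cox_length n \<one>\<^bsub>affine_sym n\<^esub> = 0"
  unfolding cox_length_def
  by (rule Least_equality) (auto simp: affine_sym_one intro: bexI[of _ "[]"])

lemma affine_sym_one_closed: "\<one>\<^bsub>affine_sym n\<^esub> \<in> carrier (affine_sym n)"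
  by (simp add: group.is_monoid group_affine_sym monoid.one_closed)

text \<open>The iterated action on the identity lies in degree \<open>sum_list as\<close>, and a
  nonzero coefficient means that \<open>w\<close> occurs in it. This homogeneity bounds the degree
  and makes the final expansion finite.\<close>

lemma stanley_coeff_degree:
  assumes "n \<ge> 3" "\<forall>a \<in> set as. a < n" "stanley_coeff n w as \<noteq> 0"
  shows "sum_list as = cox_length n w"
proof -
  let ?v = "fold (\<lambda>a. nil_act n (nil_h n a)) as (basis_vec \<one>\<^bsub>affine_sym n\<^esub>)"
  have "fold (\<lambda>a. nil_act n (nil_h n a)) as v \<in> graded_space n (l + sum_list as)"
    if "v \<in> graded_space n l" for v l
    using assms(2) that
  proof (induction as arbitrary: v l)
    case (Cons a as)
    then have "nil_act n (nil_h n a) v \<in> graded_space n (l + a)"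
      using nil_h_graded[OF assms(1)] by simp
    then have "fold (\<lambda>a. nil_act n (nil_h n a)) as (nil_act n (nil_h n a) v) \<in>
        graded_space n (l + a + sum_list as)"
      using Cons by simp
    then show ?case by (simp add: add.assoc)
  qed simp
  moreover have "basis_vec \<one>\<^bsub>affine_sym n\<^esub> \<in> graded_space n 0"
    using basis_vec_closed[OF affine_sym_one_closed] cox_length_one
    by (auto simp: graded_space_def basis_vec_def)
  ultimately have "?v \<in> graded_space n (sum_list as)" by force
  moreover have "w \<in> Poly_Mapping.keys ?v"
  proof (rule ccontr)
    assume "w \<notin> Poly_Mapping.keys ?v"
    then have "stanley_coeff n w as = 0"
      unfolding stanley_coeff_def pairing_def
      by (intro sum.neutral) (auto simp: lookup_basis_vec)
    with assms(3) show False by simp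
  qed
  ultimately show ?thesis by (auto simp: graded_space_def)
qed

lemma stanley_coeff_mset_nonzero:
  assumes "n \<ge> 3" "\<forall>a \<in> set as. a < n" "\<forall>b \<in> set bs. b < n"
    and "filter_mset (\<lambda>a. a \<noteq> 0) (mset as) = filter_mset (\<lambda>a. a \<noteq> 0) (mset bs)"
  shows "stanley_coeff n w as = stanley_coeff n w bs"
proof -
  have "stanley_coeff n w cs = stanley_coeff n w (sorted_list_of_multiset (filter_mset (\<lambda>a. a \<noteq> 0) (mset cs)))"
    if cs: "\<forall>a \<in> set cs. a < n" for cs
  proof -
    let ?M = "filter_mset (\<lambda>a. a \<noteq> 0) (mset cs)"
    let ?k = "count (mset cs) 0"
    have "mset cs = mset (sorted_list_of_multiset ?M @ replicate ?k 0)"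
      by (rule multiset_eqI) auto
    then have "stanley_coeff n w cs = stanley_coeff n w (sorted_list_of_multiset ?M @ replicate ?k 0)"
      unfolding stanley_coeff_def
      using nil_act_fold_mset[OF assms(1) cs basis_vec_closed[OF affine_sym_one_closed]] by metis
    also have "\<dots> = stanley_coeff n w (sorted_list_of_multiset ?M)"
      using assms(1) cs by (intro stanley_coeff_append_zeros) auto
    finally show ?thesis .
  qed
  then show ?thesis using assms by metis
qed

section \<open>Symmetry of the affine Stanley functions\<close>

text \<open>This is the partition that \<open>monomial_sym\<close> compares with its index, so
  \<open>monomial_sym \<mu>\<close> is the indicator of
  \<open>exponents \<alpha> = \<mu>\<close>.\<close>

definition exponents :: "(nat \<Rightarrow>\<^sub>0 nat) \<Rightarrow> nat multiset" where
  "exponents \<alpha> = image_mset (Poly_Mapping.lookup \<alpha>) (mset_set (Poly_Mapping.keys \<alpha>))"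

lemma exponents_map_key:
  assumes "bij \<sigma>"
  shows "exponents (Poly_Mapping.map_key \<sigma> \<alpha>) = exponents \<alpha>"
proof -
  have inj: "inj \<sigma>" and surj: "surj \<sigma>" using assms by (auto simp: bij_def)
  have "Poly_Mapping.keys \<alpha> = \<sigma> ` Poly_Mapping.keys (Poly_Mapping.map_key \<sigma> \<alpha>)"
    unfolding keys_map_key[OF inj] using surj by (simp add: surj_image_vimage_eq)
  moreover have "inj_on \<sigma> (Poly_Mapping.keys (Poly_Mapping.map_key \<sigma> \<alpha>))"
    using inj inj_on_subset by blast
  ultimately have "mset_set (Poly_Mapping.keys \<alpha>) =
      image_mset \<sigma> (mset_set (Poly_Mapping.keys (Poly_Mapping.map_key \<sigma> \<alpha>)))"
    by (simp add: image_mset_mset_set)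
  then show ?thesis
    by (simp add: exponents_def multiset.map_comp comp_def map_key.rep_eq[OF inj])
qed

lemma zero_notin_exponents: "0 \<notin># exponents \<alpha>"
  by (auto simp: exponents_def in_keys_iff)

lemma exponents_le_iff: "(\<forall>i. Poly_Mapping.lookup \<alpha> i \<le> m) \<longleftrightarrow> (\<forall>p \<in># exponents \<alpha>. p \<le> m)"
  by (auto simp: exponents_def in_keys_iff)

lemma sum_mset_exponents:
  "sum_mset (exponents \<alpha>) = (\<Sum>i \<in> Poly_Mapping.keys \<alpha>. Poly_Mapping.lookup \<alpha> i)"
  by (simp add: exponents_def sum_unfold_sum_mset)

lemma filter_mset_lookup_list:
  "filter_mset (\<lambda>a. a \<noteq> 0) (mset (map (Poly_Mapping.lookup \<alpha>) [0..<Poly_Mapping.degree \<alpha>])) = exponents \<alpha>"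
proof -
  have "{i \<in> {0..<Poly_Mapping.degree \<alpha>}. Poly_Mapping.lookup \<alpha> i \<noteq> 0} = Poly_Mapping.keys \<alpha>"
    using in_keys_less_degree[of _ \<alpha>] by (auto simp: in_keys_iff)
  then have "filter_mset (\<lambda>i. Poly_Mapping.lookup \<alpha> i \<noteq> 0) (mset_set {0..<Poly_Mapping.degree \<alpha>}) =
      mset_set (Poly_Mapping.keys \<alpha>)"
    by (simp add: filter_mset_mset_set)
  then show ?thesis
    by (simp add: exponents_def filter_mset_image_mset comp_def)
qed

text \<open>Both claims of the theorem are read off from this form: invariance under permutations of
  the variables, and the coefficients of the monomial functions.\<close>

lemma affine_stanley_exponents:
  assumes "n \<ge> 3"
  shows "affine_stanley n w \<alpha> =
    (if \<forall>p \<in># exponents \<alpha>. p \<le> n - 1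
     then stanley_coeff n w (sorted_list_of_multiset (exponents \<alpha>)) else 0)"
proof (cases "\<forall>p \<in># exponents \<alpha>. p \<le> n - 1")
  case True
  then have le: "Poly_Mapping.lookup \<alpha> i \<le> n - 1" for i
    by (simp only: flip: exponents_le_iff)
  have filter: "filter_mset (\<lambda>a. a \<noteq> 0) (exponents \<alpha>) = exponents \<alpha>"
    using zero_notin_exponents[of \<alpha>] by (auto simp: filter_mset_eq_conv intro: gr0I)
  have p: "p < n" if "p \<in># exponents \<alpha>" for p using True that assms by force
  have i: "Poly_Mapping.lookup \<alpha> i < n" for i using le[of i] assms by simp
  have "stanley_coeff n w (map (Poly_Mapping.lookup \<alpha>) [0..<Poly_Mapping.degree \<alpha>]) =
      stanley_coeff n w (sorted_list_of_multiset (exponents \<alpha>))"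
    by (rule stanley_coeff_mset_nonzero[OF assms])
      (unfold filter_mset_lookup_list, use p i filter in auto)
  with True le show ?thesis by (simp add: affine_stanley_def)
next
  case False
  then show ?thesis unfolding affine_stanley_def exponents_le_iff by (simp only: if_False)
qed

lemma sum_apply: "(\<Sum>a\<in>A. f a) x = (\<Sum>a\<in>A. f a x)"
  for f :: "'a \<Rightarrow> 'b \<Rightarrow> 'c::comm_monoid_add"
  by (induction A rule: infinite_finite_induct) (simp_all add: zero_fun_def)

theorem theorem5p4:
  fixes n :: nat and w :: "nat list set"
  assumes "n \<ge> 3" and "w \<in> carrier (affine_sym n)"
  shows "symmetric_function (affine_stanley n w) \<and> affine_stanley n w \<in> Lambda_bounded n"
proof
  note F = affine_stanley_exponents[OF assms(1), of w]
  let ?d = "cox_length n w"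
  have degree: "sum_mset (exponents \<alpha>) = ?d" "\<forall>p \<in># exponents \<alpha>. p \<le> n - 1"
    if "affine_stanley n w \<alpha> \<noteq> 0" for \<alpha>
  proof -
    show le: "\<forall>p \<in># exponents \<alpha>. p \<le> n - 1" using that by (auto simp: F split: if_splits)
    have "p < n" if "p \<in># exponents \<alpha>" for p using le that assms(1) by force
    then have "sum_list (sorted_list_of_multiset (exponents \<alpha>)) = ?d"
      using that by (intro stanley_coeff_degree[OF assms(1)]) (auto simp: F split: if_splits)
    then show "sum_mset (exponents \<alpha>) = ?d" by (simp flip: sum_mset_sum_list)
  qed
  show "symmetric_function (affine_stanley n w)"
    unfolding symmetric_function_def
  proof (intro conjI allI impI exI[of _ ?d])
    show "affine_stanley n w (Poly_Mapping.map_key \<sigma> \<alpha>) = affine_stanley n w \<alpha>" if "bij \<sigma>" for \<sigma> \<alpha>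
      by (simp add: F exponents_map_key[OF that])
    show "(\<Sum>i \<in> Poly_Mapping.keys \<alpha>. Poly_Mapping.lookup \<alpha> i) \<le> ?d" if "affine_stanley n w \<alpha> \<noteq> 0" for \<alpha>
      using degree(1)[OF that] by (simp add: sum_mset_exponents)
  qed
  interpret module "\<lambda>c (F :: power_series) \<alpha>. c * F \<alpha>"
    by standard (auto simp: fun_eq_iff algebra_simps)
  \<comment> \<open>The partitions of \<open>?d\<close> with parts at most \<open>n - 1\<close>.
    There are finitely many, because positive parts with sum \<open>?d\<close> number at most
    \<open>?d\<close>.\<close>
  define M where "M = {\<mu>. 0 \<notin># \<mu> \<and> (\<forall>p \<in># \<mu>. p \<le> n - 1) \<and> sum_mset \<mu> = ?d}"
  have "finite M"
  proof (rule finite_subset)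
    show "M \<subseteq> mset ` {xs. set xs \<subseteq> {..n} \<and> length xs \<le> ?d}"
    proof
      fix \<mu> assume \<mu>: "\<mu> \<in> M"
      have "size \<mu> = (\<Sum>p \<in># \<mu>. 1)" by (simp add: size_multiset_overloaded_eq)
      also have "\<dots> \<le> (\<Sum>p \<in># \<mu>. p)"
        using \<mu> by (intro sum_mset_mono) (auto simp: M_def Suc_le_eq intro: gr0I)
      also have "\<dots> = ?d" using \<mu> by (simp add: M_def)
      finally have "length (sorted_list_of_multiset \<mu>) \<le> ?d"
        by (metis mset_sorted_list_of_multiset size_mset)
      moreover have "set (sorted_list_of_multiset \<mu>) \<subseteq> {..n}" using \<mu> by (force simp: M_def)
      ultimately show "\<mu> \<in> mset ` {xs. set xs \<subseteq> {..n} \<and> length xs \<le> ?d}"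
        by (intro image_eqI[of _ _ "sorted_list_of_multiset \<mu>"]) auto
    qed
  qed (simp add: finite_lists_length_le)
  let ?c = "\<lambda>\<mu>. stanley_coeff n w (sorted_list_of_multiset \<mu>)"
  have "affine_stanley n w = (\<Sum>\<mu>\<in>M. (\<lambda>\<alpha>. ?c \<mu> * monomial_sym \<mu> \<alpha>))"
  proof
    fix \<alpha>
    have "(\<Sum>\<mu>\<in>M. (\<lambda>\<alpha>. ?c \<mu> * monomial_sym \<mu> \<alpha>)) \<alpha> = (\<Sum>\<mu>\<in>M. ?c \<mu> * monomial_sym \<mu> \<alpha>)"
      by (rule sum_apply)
    also have "\<dots> = (\<Sum>\<mu>\<in>M. if \<mu> = exponents \<alpha> then ?c \<mu> else 0)"
      by (intro sum.cong) (auto simp: monomial_sym_def exponents_def)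
    also have "\<dots> = (if exponents \<alpha> \<in> M then ?c (exponents \<alpha>) else 0)"
      using \<open>finite M\<close> by simp
    also have "\<dots> = affine_stanley n w \<alpha>"
    proof (cases "exponents \<alpha> \<in> M")
      case True
      then show ?thesis by (simp add: F M_def)
    next
      case False
      \<comment> \<open>Outside \<open>M\<close>, the exponents violate the bound on the parts or
        have the wrong total degree.\<close>
      then have "affine_stanley n w \<alpha> = 0"
        using degree[of \<alpha>] zero_notin_exponents[of \<alpha>] unfolding M_def by blast
      with False show ?thesis by simp
    qed
    finally show "affine_stanley n w \<alpha> = (\<Sum>\<mu>\<in>M. (\<lambda>\<alpha>. ?c \<mu> * monomial_sym \<mu> \<alpha>)) \<alpha>"
      by (rule sym)
  qed
  also have "\<dots> \<in> Lambda_bounded n"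
    unfolding Lambda_bounded_def
  proof (rule span_sum)
    fix \<mu> assume "\<mu> \<in> M"
    then have "monomial_sym \<mu> \<in> span {monomial_sym \<mu> | \<mu>. 0 \<notin># \<mu> \<and> (\<forall>p \<in># \<mu>. p \<le> n - 1)}"
      by (intro span_base) (auto simp: M_def)
    then show "(\<lambda>\<alpha>. ?c \<mu> * monomial_sym \<mu> \<alpha>) \<in>
        span {monomial_sym \<mu> | \<mu>. 0 \<notin># \<mu> \<and> (\<forall>p \<in># \<mu>. p \<le> n - 1)}"
      by (rule span_scale)
  qed
  finally show "affine_stanley n w \<in> Lambda_bounded n" .
qed

end
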